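(* For $2-\frac{\sqrt2}{2}\le R\le 17-9\sqrt3$, the following algorithm is $\frac{\sqrt{16R+1}-1}{2R}$-competitive for the proportional\&removable online knapsack problem with a buffer of capacity $R$. Let $r=\frac{\sqrt{16R+1}+1}{8}$. Call an item $e$ small if $s(e)\le 1-r$, medium if $1-r<s(e)<r$, large if $s(e)\ge r$; let $S$ be the set of small items, and split the medium items into $M_1=\{e:1-r<s(e)<2r-1\}$, $M_2=\{e:2r-1\le s(e)<1/2\}$, $M_3=\{e:1/2\le s(e)<r^2\}$, $M_4=\{e:r^2\le s(e)<r\}$. Start with $B_0=\emptyset$. In round $i$: if there exists $B'\subseteq B_{i-1}\cup\{e_i\}$ with $r\le s(B')\le 1$, set $B_i=B'$ for such a $B'$. Otherwise: set $B_i=\emptyset$ and $A_j=(B_{i-1}\cup\{e_i\})\cap M_j$ for $j=1,2,3,4$. (a) If $A_1\cup A_2\cup A_3\neq\emptyset$, let $a$ be an item of minimum size in $A_1\cup A_2\cup A_3$ and set $B_i=\{a\}$. (b) If $|A_1|\ge 2$, let $b$ be an item of minimum size in $A_1\setminus B_i$; if $s(B_i)+s(b)\le\min_{e\in A_4}s(e)$ (where the minimum over an empty set is $+\infty$), add $b$ to $B_i$. (c) If $A_4\ne\emptyset$ and $|B_i\cap M_1|\le 1$, add an item of minimum size in $A_4$ to $B_i$. (d) If ($|B_i\cap M_1|=2$ and $s(B_i\cap M_1)\le R-r$) or ($|B_i\cap M_4|=1$ and $s(B_i\cap M_4)\le R-r$), let $a$ be an item of minimum size in $(A_1\cup A_2\cup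 A_3\cup A_4)\setminus B_i$, and if $s(B_i)+s(a)\le R$ add $a$ to $B_i$. (e) Add all items of $(B_{i-1}\cup\{e_i\})\cap S$ to $B_i$.
   Context: Online knapsack problem with a resource buffer: there is a knapsack of capacity $1$ and a buffer of capacity $R\ge 1$. Items $e_1,\dots,e_n$ arrive one by one; each item $e$ has size $0<s(e)\le 1$ and value $v(e)\ge 0$; $s(B),v(B)$ denote sums over a set $B$. A deterministic online algorithm maintains buffer contents $B_0=\emptyset,B_1,\dots,B_n$, with $B_i$ chosen after seeing only $e_1,\dots,e_i$, $B_i\subseteq B_{i-1}\cup\{e_i\}$ and $s(B_i)\le R$ (removable setting). $\mathrm{ALG}(I)=\max\{v(B)\mid B\subseteq B_n,\ s(B)\le 1\}$, $\mathrm{OPT}(I)=\max\{v(B)\mid B\subseteq\{e_1,\dots,e_n\},\ s(B)\le 1\}$. "Proportional" means $v(e)=s(e)$ for every item. An algorithm is $c$-competitive if $\mathrm{OPT}(I)\le c\cdot\mathrm{ALG}(I)$ for every input $I$. Ties are broken arbitrarily. *)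

theory Defs
  imports Complex_Main
begin

section \<open>The online knapsack problem with a resource buffer\<close>

datatype item = Item (item_size: real) (item_value: real)

text \<open>
  An input is the list of its items in order of arrival. Sets of items of an input \<open>I\<close> are
  represented by sets of positions in \<open>I\<close>, so that distinct items may have equal size and value.
\<close>

definition total_size :: "item list \<Rightarrow> nat set \<Rightarrow> real" where
  "total_size I B = (\<Sum>k\<in>B. item_size (I ! k))"

definition total_value :: "item list \<Rightarrow> nat set \<Rightarrow> real" where
  "total_value I B = (\<Sum>k\<in>B. item_value (I ! k))"

definition knapsack_inputs :: "item list set" where
  "knapsack_inputs = {I. \<forall>e\<in>set I. 0 < item_size e \<and> item_size e \<le> 1 \<and> 0 \<le> item_value e}"

definition proportional_inputs :: "item list set" where
  "proportional_inputs = {I \<in> knapsack_inputs. \<forall>e\<in>set I. item_value e = item_size e}"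

text \<open>
  A deterministic online algorithm maps the list of the items seen so far to the current buffer
  contents. The set \<open>X\<close> is the class of admissible inputs.
\<close>

definition removable_online_algorithm ::
  "real \<Rightarrow> item list set \<Rightarrow> (item list \<Rightarrow> nat set) \<Rightarrow> bool" where
  "removable_online_algorithm R X alg \<longleftrightarrow>
     alg [] = {} \<and>
     (\<forall>I e. I @ [e] \<in> X \<longrightarrow>
        alg (I @ [e]) \<subseteq> insert (length I) (alg I) \<and>
        total_size (I @ [e]) (alg (I @ [e])) \<le> R)"

definition best_packing :: "item list \<Rightarrow> nat set \<Rightarrow> real" where
  "best_packing I C = Max {total_value I B |B. B \<subseteq> C \<and> total_size I B \<le> 1}"

definition ALG :: "(item list \<Rightarrow> nat set) \<Rightarrow> item list \<Rightarrow> real" where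
  "ALG alg I = best_packing I (alg I)"

definition OPT :: "item list \<Rightarrow> real" where
  "OPT I = best_packing I {..<length I}"

definition competitive :: "real \<Rightarrow> item list set \<Rightarrow> (item list \<Rightarrow> nat set) \<Rightarrow> bool" where
  "competitive c X alg \<longleftrightarrow> (\<forall>I\<in>X. OPT I \<le> c * ALG alg I)"


section \<open>The algorithm\<close>

text \<open>
  Below, \<open>s\<close> gives the sizes of the items, \<open>C\<close> is the old buffer together with the new item,
  and \<open>M1 r s C\<close> is the set of those items in \<open>C\<close> that belong to the class \<open>M1\<close>; thus the sets
  \<open>A1\<close>, ..., \<open>A4\<close> of a round are \<open>M1 r s C\<close>, ..., \<open>M4 r s C\<close>.
\<close>

definition threshold :: "real \<Rightarrow> real" where
  "threshold R = (sqrt (16 * R + 1) + 1) / 8"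

definition small :: "real \<Rightarrow> (nat \<Rightarrow> real) \<Rightarrow> nat set \<Rightarrow> nat set" where
  "small r s C = {e \<in> C. s e \<le> 1 - r}"

definition M1 :: "real \<Rightarrow> (nat \<Rightarrow> real) \<Rightarrow> nat set \<Rightarrow> nat set" where
  "M1 r s C = {e \<in> C. 1 - r < s e \<and> s e < 2 * r - 1}"

definition M2 :: "real \<Rightarrow> (nat \<Rightarrow> real) \<Rightarrow> nat set \<Rightarrow> nat set" where
  "M2 r s C = {e \<in> C. 2 * r - 1 \<le> s e \<and> s e < 1 / 2}"

definition M3 :: "real \<Rightarrow> (nat \<Rightarrow> real) \<Rightarrow> nat set \<Rightarrow> nat set" where
  "M3 r s C = {e \<in> C. 1 / 2 \<le> s e \<and> s e < r\<^sup>2}"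

definition M4 :: "real \<Rightarrow> (nat \<Rightarrow> real) \<Rightarrow> nat set \<Rightarrow> nat set" where
  "M4 r s C = {e \<in> C. r\<^sup>2 \<le> s e \<and> s e < r}"

text \<open>
  Ties are broken arbitrarily, so every step is a relation between the contents \<open>B\<close> of the new
  buffer before the step and its contents \<open>B'\<close> after the step.
\<close>

definition step_a :: "real \<Rightarrow> (nat \<Rightarrow> real) \<Rightarrow> nat set \<Rightarrow> nat set \<Rightarrow> nat set \<Rightarrow> bool" where
  "step_a r s C B B' \<longleftrightarrow>
     (if M1 r s C \<union> M2 r s C \<union> M3 r s C \<noteq> {}
      then \<exists>a. is_arg_min s (\<lambda>x. x \<in> M1 r s C \<union> M2 r s C \<union> M3 r s C) a \<and> B' = {a}
      else B' = B)"

definition step_b :: "real \<Rightarrow> (nat \<Rightarrow> real) \<Rightarrow> nat set \<Rightarrow> nat set \<Rightarrow> nat set \<Rightarrow> bool" where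
  "step_b r s C B B' \<longleftrightarrow>
     (if card (M1 r s C) \<ge> 2
      then \<exists>b. is_arg_min s (\<lambda>x. x \<in> M1 r s C - B) b \<and>
             B' = (if M4 r s C = {} \<or> sum s B + s b \<le> Min (s ` M4 r s C)
                   then insert b B else B)
      else B' = B)"

definition step_c :: "real \<Rightarrow> (nat \<Rightarrow> real) \<Rightarrow> nat set \<Rightarrow> nat set \<Rightarrow> nat set \<Rightarrow> bool" where
  "step_c r s C B B' \<longleftrightarrow>
     (if M4 r s C \<noteq> {} \<and> card (M1 r s B) \<le> 1
      then \<exists>a. is_arg_min s (\<lambda>x. x \<in> M4 r s C) a \<and> B' = insert a B
      else B' = B)"

definition step_d ::
  "real \<Rightarrow> real \<Rightarrow> (nat \<Rightarrow> real) \<Rightarrow> nat set \<Rightarrow> nat set \<Rightarrow> nat set \<Rightarrow> bool" where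
  "step_d R r s C B B' \<longleftrightarrow>
     (let A = (M1 r s C \<union> M2 r s C \<union> M3 r s C \<union> M4 r s C) - B in
      if ((card (M1 r s B) = 2 \<and> sum s (M1 r s B) \<le> R - r) \<or>
          (card (M4 r s B) = 1 \<and> sum s (M4 r s B) \<le> R - r)) \<and> A \<noteq> {}
      then \<exists>a. is_arg_min s (\<lambda>x. x \<in> A) a \<and>
             B' = (if sum s B + s a \<le> R then insert a B else B)
      else B' = B)"

definition step_e :: "real \<Rightarrow> (nat \<Rightarrow> real) \<Rightarrow> nat set \<Rightarrow> nat set \<Rightarrow> nat set \<Rightarrow> bool" where
  "step_e r s C B B' \<longleftrightarrow> B' = B \<union> small r s C"

definition algorithm_round :: "real \<Rightarrow> (nat \<Rightarrow> real) \<Rightarrow> nat set \<Rightarrow> nat set \<Rightarrow> bool" where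
  "algorithm_round R s C B' \<longleftrightarrow>
     (let r = threshold R in
      if \<exists>D\<subseteq>C. r \<le> sum s D \<and> sum s D \<le> 1
      then B' \<subseteq> C \<and> r \<le> sum s B' \<and> sum s B' \<le> 1
      else \<exists>Ba Bb Bc Bd.
             step_a r s C {} Ba \<and> step_b r s C Ba Bb \<and> step_c r s C Bb Bc \<and>
             step_d R r s C Bc Bd \<and> step_e r s C Bd B')"

definition implements_algorithm ::
  "real \<Rightarrow> item list set \<Rightarrow> (item list \<Rightarrow> nat set) \<Rightarrow> bool" where
  "implements_algorithm R X alg \<longleftrightarrow>
     alg [] = {} \<and>
     (\<forall>I e. I @ [e] \<in> X \<longrightarrow>
        algorithm_round R (\<lambda>k. item_size ((I @ [e]) ! k)) (insert (length I) (alg I))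
          (alg (I @ [e])))"


section \<open>Every round of the algorithm can be carried out\<close>

lemma ex_is_arg_min_finite:
  fixes s :: "nat \<Rightarrow> real"
  assumes "finite A" "A \<noteq> {}"
  shows "\<exists>a. is_arg_min s (\<lambda>x. x \<in> A) a"
  using ex_is_arg_min_if_finite[OF assms, of s] by simp

lemma ex_step_a:
  assumes "finite C"
  shows "\<exists>B'. step_a r s C B B'"
proof (cases "M1 r s C \<union> M2 r s C \<union> M3 r s C = {}")
  case False
  have "finite (M1 r s C \<union> M2 r s C \<union> M3 r s C)"
    using assms by (simp add: M1_def M2_def M3_def)
  from ex_is_arg_min_finite[OF this False, of s]
  show ?thesis unfolding step_a_def if_P[OF False] by blast
qed (simp add: step_a_def)

lemma step_a_card: "step_a r s C {} B' \<Longrightarrow> finite B' \<and> card B' \<le> 1"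
  by (auto simp: step_a_def split: if_splits)

lemma ex_step_b:
  assumes "finite C" "finite B" "card B \<le> 1"
  shows "\<exists>B'. step_b r s C B B'"
proof (cases "card (M1 r s C) \<ge> 2")
  case True
  have "finite (M1 r s C - B)" using assms by (simp add: M1_def)
  moreover have "M1 r s C - B \<noteq> {}"
  proof
    assume "M1 r s C - B = {}"
    then have "card (M1 r s C) \<le> card B" using assms by (simp add: card_mono)
    then show False using True assms by linarith
  qed
  ultimately obtain b where "is_arg_min s (\<lambda>x. x \<in> M1 r s C - B) b"
    using ex_is_arg_min_finite[of "M1 r s C - B" s] by blast
  then show ?thesis unfolding step_b_def if_P[OF True] by blast
next
  case False
  show ?thesis unfolding step_b_def if_not_P[OF False] by blast
qed

lemma ex_step_c:
  assumes "finite C"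
  shows "\<exists>B'. step_c r s C B B'"
proof (cases "M4 r s C \<noteq> {} \<and> card (M1 r s B) \<le> 1")
  case True
  have "finite (M4 r s C)" using assms by (simp add: M4_def)
  from ex_is_arg_min_finite[OF this conjunct1[OF True], of s]
  show ?thesis unfolding step_c_def if_P[OF True] by blast
next
  case False
  show ?thesis unfolding step_c_def if_not_P[OF False] by blast
qed

lemma ex_step_d:
  assumes "finite C"
  shows "\<exists>B'. step_d R r s C B B'"
proof -
  define A where "A = (M1 r s C \<union> M2 r s C \<union> M3 r s C \<union> M4 r s C) - B"
  define P where "P \<longleftrightarrow> (card (M1 r s B) = 2 \<and> sum s (M1 r s B) \<le> R - r) \<or>
          (card (M4 r s B) = 1 \<and> sum s (M4 r s B) \<le> R - r)"
  have step_d_iff: "step_d R r s C B B' \<longleftrightarrow>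
     (if P \<and> A \<noteq> {}
      then \<exists>a. is_arg_min s (\<lambda>x. x \<in> A) a \<and>
             B' = (if sum s B + s a \<le> R then insert a B else B)
      else B' = B)" for B'
    unfolding step_d_def Let_def A_def P_def ..
  show ?thesis
  proof (cases "P \<and> A \<noteq> {}")
    case True
    have "finite A"
      using assms by (simp add: A_def M1_def M2_def M3_def M4_def)
    from ex_is_arg_min_finite[OF this conjunct2[OF True], of s]
    show ?thesis unfolding step_d_iff if_P[OF True] by blast
  next
    case False
    show ?thesis unfolding step_d_iff if_not_P[OF False] by blast
  qed
qed

lemma ex_algorithm_round:
  assumes "finite C"
  shows "\<exists>B'. algorithm_round R s C B'"
proof -
  obtain Ba where a: "step_a (threshold R) s C {} Ba" using ex_step_a[OF assms] by blast
  obtain Bb where b: "step_b (threshold R) s C Ba Bb"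
    using ex_step_b[OF assms] step_a_card[OF a] by blast
  obtain Bc where c: "step_c (threshold R) s C Bb Bc" using ex_step_c[OF assms] by blast
  obtain Bd where d: "step_d R (threshold R) s C Bc Bd" using ex_step_d[OF assms] by blast
  show ?thesis
  proof (cases "\<exists>D\<subseteq>C. threshold R \<le> sum s D \<and> sum s D \<le> 1")
    case True
    then show ?thesis unfolding algorithm_round_def Let_def if_P[OF True] .
  next
    case False
    have "step_e (threshold R) s C Bd (Bd \<union> small (threshold R) s C)" by (simp add: step_e_def)
    with a b c d show ?thesis unfolding algorithm_round_def Let_def if_not_P[OF False] by blast
  qed
qed

lemma class_subsets:
  "M1 r s C \<subseteq> C" "M2 r s C \<subseteq> C" "M3 r s C \<subseteq> C" "M4 r s C \<subseteq> C" "small r s C \<subseteq> C"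
  by (simp_all add: M1_def M2_def M3_def M4_def small_def)

lemma is_arg_min_memD: "is_arg_min s (\<lambda>x. x \<in> A) a \<Longrightarrow> a \<in> A"
  by (simp add: is_arg_min_def)

lemma step_a_subset:
  assumes "step_a r s C {} B'"
  shows "B' \<subseteq> C"
proof (cases "M1 r s C \<union> M2 r s C \<union> M3 r s C \<noteq> {}")
  case True
  obtain a where "a \<in> M1 r s C \<union> M2 r s C \<union> M3 r s C" "B' = {a}"
    using assms unfolding step_a_def if_P[OF True] by (blast dest: is_arg_min_memD)
  then show ?thesis using class_subsets[of r s C] by blast
next
  case False
  then show ?thesis using assms unfolding step_a_def if_not_P[OF False] by simp
qed

lemma step_b_subset:
  assumes "step_b r s C B B'"
  shows "B' \<subseteq> B \<union> C"
proof (cases "card (M1 r s C) \<ge> 2")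
  case True
  obtain b where "b \<in> M1 r s C - B" "B' = insert b B \<or> B' = B"
    using assms unfolding step_b_def if_P[OF True] by (metis is_arg_min_memD)
  then show ?thesis using class_subsets[of r s C] by blast
next
  case False
  then show ?thesis using assms unfolding step_b_def if_not_P[OF False] by simp
qed

lemma step_c_subset:
  assumes "step_c r s C B B'"
  shows "B' \<subseteq> B \<union> C"
proof (cases "M4 r s C \<noteq> {} \<and> card (M1 r s B) \<le> 1")
  case True
  obtain a where "a \<in> M4 r s C" "B' = insert a B"
    using assms unfolding step_c_def if_P[OF True] by (metis is_arg_min_memD)
  then show ?thesis using class_subsets[of r s C] by blast
next
  case False
  then show ?thesis using assms unfolding step_c_def if_not_P[OF False] by simp
qed

lemma step_d_subset:
  assumes "step_d R r s C B B'"
  shows "B' \<subseteq> B \<union> C"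
proof -
  define A where "A = (M1 r s C \<union> M2 r s C \<union> M3 r s C \<union> M4 r s C) - B"
  have "B' = B \<or> (\<exists>a. is_arg_min s (\<lambda>x. x \<in> A) a \<and> (B' = insert a B \<or> B' = B))"
    using assms unfolding step_d_def Let_def A_def[symmetric] by metis
  then have "B' = B \<or> (\<exists>a\<in>A. B' = insert a B)"
    by (blast dest: is_arg_min_memD)
  moreover have "A \<subseteq> C" using class_subsets[of r s C] unfolding A_def by blast
  ultimately show ?thesis by blast
qed

lemma algorithm_round_subset:
  assumes "algorithm_round R s C B'"
  shows "B' \<subseteq> C"
proof (cases "\<exists>D\<subseteq>C. threshold R \<le> sum s D \<and> sum s D \<le> 1")
  case True
  then show ?thesis using assms by (simp add: algorithm_round_def Let_def)
next
  case False
  obtain Ba Bb Bc Bd where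
    "step_a (threshold R) s C {} Ba" "step_b (threshold R) s C Ba Bb"
    "step_c (threshold R) s C Bb Bc" "step_d R (threshold R) s C Bc Bd"
    "step_e (threshold R) s C Bd B'"
    using assms unfolding algorithm_round_def Let_def if_not_P[OF False] by blast
  note steps = this
  have "Bd \<subseteq> C"
    using step_a_subset[OF steps(1)] step_b_subset[OF steps(2)] step_c_subset[OF steps(3)]
      step_d_subset[OF steps(4)] by blast
  then show ?thesis
    using steps(5) class_subsets(5)[of "threshold R" s C] unfolding step_e_def by blast
qed

lemma ex_implements_algorithm: "\<exists>alg. implements_algorithm R X alg"
proof -
  define f where "f = rec_list {} (\<lambda>e xs B. SOME B'. algorithm_round R
    (\<lambda>k. item_size ((rev xs @ [e]) ! k)) (insert (length xs) B) B')"
  define alg where "alg I = f (rev I)" for I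
  have alg_snoc: "alg (I @ [e]) = (SOME B'. algorithm_round R
      (\<lambda>k. item_size ((I @ [e]) ! k)) (insert (length I) (alg I)) B')" for I e
    by (simp add: alg_def f_def)
  have step: "algorithm_round R (\<lambda>k. item_size ((I @ [e]) ! k)) (insert (length I) (alg I))
      (alg (I @ [e]))" if "finite (alg I)" for I e
    unfolding alg_snoc by (rule someI_ex, rule ex_algorithm_round) (use that in simp)
  have "finite (alg I)" for I
  proof (induction I rule: rev_induct)
    case Nil
    then show ?case by (simp add: alg_def f_def)
  next
    case (snoc e I)
    then show ?case
      using algorithm_round_subset[OF step[OF snoc, of e]] by (meson finite.insertI finite_subset)
  qed
  moreover have "alg [] = {}"
    by (simp add: alg_def f_def)
  ultimately have "implements_algorithm R X alg"
    unfolding implements_algorithm_def using step by blast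
  then show ?thesis by blast
qed

end

(* Put r = threshold R, so that R = 4 r^2 - r and the claimed ratio is 1 / r. As soon as the buffer
   holds a subset of size in [r, 1] the algorithm keeps one, and OPT <= 1 settles the claim. Before
   that, every small item is kept, and all of them fit on top of any feasible packing of the buffer,
   because an item of size at most 1 - r cannot jump over [r, 1]; so it suffices to compare the
   non-small parts of the two packings. Call a single item of
   M4 or a pair of items of M1 a unit. A unit has size at least r^2 and at most 1, and a unit
   together with any further non-small item has size at least r. The buffer retains the smallest
   non-small item of size below r^2 and a unit at most as large as any unit seen so far, hence no
   feasible packing of the items seen contains three non-small items, or two of them that are not
   both in M1. A packing of size at most r is matched by the retained unit, if there is one; otherwise
   it is a single item, of size below r^2 and matched by the retained smallest item, which is the
   same item or has size at least 2 r - 1 >= r^3. For a pair x, y in M1 with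
   larger sum, the smallest item a satisfies s x + s y <= 2 r - 2 s a, while step (d) ensures that
   the buffer still holds x and y, or a unit of size at least R - r = r (4 r - 2), or a unit of
   size more than 1 - s a >= r (2 r - 2 s a). *)

theory Submission
  imports Defs
begin

section \<open>Units and the invariant of the buffer\<close>

definition admissible :: "real \<Rightarrow> (nat \<Rightarrow> real) \<Rightarrow> nat set \<Rightarrow> bool" where
  "admissible r s C \<longleftrightarrow> (\<forall>D\<subseteq>C. \<not> (r \<le> sum s D \<and> sum s D \<le> 1))"

definition unit :: "real \<Rightarrow> (nat \<Rightarrow> real) \<Rightarrow> nat set \<Rightarrow> bool" where
  "unit r s U \<longleftrightarrow>
     (\<exists>c. U = {c} \<and> r\<^sup>2 \<le> s c \<and> s c < r) \<or>
     (\<exists>p q. U = {p, q} \<and> p \<noteq> q \<and> 1 - r < s p \<and> s p < 2 * r - 1 \<and> 1 - r < s q \<and> s q < 2 * r - 1)"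

text \<open>The buffers that can match a pair of \<open>M1\<close> items of which one has been discarded.\<close>

definition rich :: "real \<Rightarrow> real \<Rightarrow> (nat \<Rightarrow> real) \<Rightarrow> nat set \<Rightarrow> bool" where
  "rich R r s B \<longleftrightarrow>
     M4 r s B \<noteq> {} \<or>
     (\<exists>p\<in>M1 r s B. \<exists>q\<in>M1 r s B. \<exists>t\<in>M1 r s B. p \<noteq> q \<and> p \<noteq> t \<and> q \<noteq> t) \<or>
     (\<exists>p\<in>M1 r s B. \<exists>q\<in>M1 r s B. p \<noteq> q \<and> R - r \<le> s p + s q)"

text \<open>Most of the \<open>n\<close> items seen may have been discarded, whereas admissibility
  is available for the buffer only. Hence facts that admissibility yields while an item is present,
  such as \<open>s a + s y < r\<close> for the smallest item \<open>a\<close>, are recorded for all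
  items seen, so that they survive the removal of \<open>y\<close>.\<close>

definition invariant :: "real \<Rightarrow> real \<Rightarrow> (nat \<Rightarrow> real) \<Rightarrow> nat \<Rightarrow> nat set \<Rightarrow> bool" where
  "invariant R r s n B \<longleftrightarrow>
     B \<subseteq> {..<n} \<and>
     (\<forall>k<n. 0 < s k \<and> s k < r) \<and>
     (\<forall>k<n. s k \<le> 1 - r \<longrightarrow> k \<in> B) \<and>
     admissible r s B \<and>
     (\<forall>x<n. 1 - r < s x \<longrightarrow> s x < r\<^sup>2 \<longrightarrow>
        (\<exists>a\<in>B. 1 - r < s a \<and> (\<forall>y<n. 1 - r < s y \<longrightarrow> s a \<le> s y) \<and>
           (\<forall>y<n. y \<noteq> a \<and> 1 - r < s y \<and> s y < 2 * r - 1 \<longrightarrow> s a + s y < r))) \<and>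
     (\<forall>x<n. \<forall>y<n. x \<noteq> y \<longrightarrow> 1 - r < s x \<longrightarrow> 1 - r < s y \<longrightarrow> s x + s y \<le> 1 \<longrightarrow>
        s x < 2 * r - 1 \<and> s y < 2 * r - 1) \<and>
     (\<forall>x<n. \<forall>y<n. \<forall>z<n. x \<noteq> y \<longrightarrow> x \<noteq> z \<longrightarrow> y \<noteq> z \<longrightarrow>
        1 - r < s x \<longrightarrow> 1 - r < s y \<longrightarrow> 1 - r < s z \<longrightarrow> 1 < s x + s y + s z) \<and>
     (\<forall>V\<subseteq>{..<n}. unit r s V \<longrightarrow> (\<exists>U\<subseteq>B. unit r s U \<and> sum s U \<le> sum s V)) \<and>
     (M1 r s {..<n} \<subseteq> B \<or> rich R r s B)"

lemma invariantD:
  assumes "invariant R r s n B"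
  shows "B \<subseteq> {..<n}"
    "\<forall>k<n. 0 < s k \<and> s k < r"
    "\<forall>k<n. s k \<le> 1 - r \<longrightarrow> k \<in> B"
    "admissible r s B"
    "\<forall>x<n. 1 - r < s x \<longrightarrow> s x < r\<^sup>2 \<longrightarrow>
        (\<exists>a\<in>B. 1 - r < s a \<and> (\<forall>y<n. 1 - r < s y \<longrightarrow> s a \<le> s y) \<and>
           (\<forall>y<n. y \<noteq> a \<and> 1 - r < s y \<and> s y < 2 * r - 1 \<longrightarrow> s a + s y < r))"
    "\<forall>x<n. \<forall>y<n. x \<noteq> y \<longrightarrow> 1 - r < s x \<longrightarrow> 1 - r < s y \<longrightarrow> s x + s y \<le> 1 \<longrightarrow>
        s x < 2 * r - 1 \<and> s y < 2 * r - 1"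
    "\<forall>x<n. \<forall>y<n. \<forall>z<n. x \<noteq> y \<longrightarrow> x \<noteq> z \<longrightarrow> y \<noteq> z \<longrightarrow>
        1 - r < s x \<longrightarrow> 1 - r < s y \<longrightarrow> 1 - r < s z \<longrightarrow> 1 < s x + s y + s z"
    "\<forall>V\<subseteq>{..<n}. unit r s V \<longrightarrow> (\<exists>U\<subseteq>B. unit r s U \<and> sum s U \<le> sum s V)"
    "M1 r s {..<n} \<subseteq> B \<or> rich R r s B"
  using assms unfolding invariant_def by - (elim conjE, assumption)+

section \<open>Packings in admissible sets, monotonicity and congruence\<close>

lemma admissibleD: "admissible r s C \<Longrightarrow> D \<subseteq> C \<Longrightarrow> sum s D \<le> 1 \<Longrightarrow> sum s D < r"
  unfolding admissible_def by (meson not_le)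

lemma admissible_mono: "admissible r s C \<Longrightarrow> B \<subseteq> C \<Longrightarrow> admissible r s B"
  unfolding admissible_def by blast

lemma admissible_pair:
  assumes "admissible r s C" "x \<in> C" "y \<in> C" "x \<noteq> y" "s x + s y \<le> 1"
  shows "s x + s y < r"
  using admissibleD[OF assms(1), of "{x, y}"] assms by simp

lemma admissible_less:
  assumes "admissible r s C" "x \<in> C" "s x \<le> 1"
  shows "s x < r"
  using admissibleD[OF assms(1), of "{x}"] assms by simp

text \<open>Induction on the small items: adding an item of size at most \<open>1 - r\<close> to a
  packing of size below \<open>r\<close> gives size at most 1, and admissibility pulls this back
  below \<open>r\<close>.\<close>

lemma admissible_add_small:
  assumes C: "admissible r s C" "finite C" and D: "D \<subseteq> C" "sum s D \<le> 1"
  shows "sum s (D \<union> small r s C) < r"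
proof -
  have "sum s (D \<union> F) < r" if "finite F" "F \<subseteq> small r s C" for F
    using that
  proof (induction F rule: finite_induct)
    case empty
    then show ?case using admissibleD[OF C(1) D] by simp
  next
    case (insert f F)
    have f: "f \<in> C" "s f \<le> 1 - r" and F: "F \<subseteq> C" and IH: "sum s (D \<union> F) < r"
      using insert by (auto simp: small_def)
    show ?case
    proof (cases "f \<in> D")
      case True
      then show ?thesis using IH by (simp add: insert_absorb)
    next
      case False
      have "finite (D \<union> F)" using C D F finite_subset by blast
      then have "sum s (D \<union> insert f F) = s f + sum s (D \<union> F)"
        using False insert.hyps by simp
      moreover from this have "sum s (D \<union> insert f F) \<le> 1" using IH f by simp
      ultimately show ?thesis
        using admissibleD[OF C(1), of "D \<union> insert f F"] D F f by auto
    qed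
  qed
  moreover have "finite (small r s C)" using C by (simp add: small_def)
  ultimately show ?thesis by blast
qed

lemma is_arg_minD: "is_arg_min s (\<lambda>x. x \<in> A) (a :: nat) \<Longrightarrow> a \<in> A \<and> (\<forall>x\<in>A. s a \<le> (s x :: real))"
  by (auto simp: is_arg_min_def not_less)

text \<open>Exchange argument: one of \<open>x\<close> and \<open>y\<close> is not \<open>a\<close>,
  hence at least as large as \<open>b\<close>, and the other is at least as large as
  \<open>a\<close>. This makes the pair chosen by steps (a) and (b) a lightest one.\<close>

lemma le_sum_pair:
  fixes s :: "nat \<Rightarrow> real"
  assumes "\<forall>z\<in>A. s a \<le> s z" "\<forall>z\<in>A - {a}. s b \<le> s z" "x \<in> A" "y \<in> A" "x \<noteq> y"
  shows "s a + s b \<le> s x + s y"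
proof (cases "x = a")
  case True
  then show ?thesis using assms by auto
next
  case False
  then have "s b \<le> s x" "s a \<le> s y" using assms by auto
  then show ?thesis by simp
qed

lemma class_mono: "A \<subseteq> B \<Longrightarrow> M1 r s A \<subseteq> M1 r s B" "A \<subseteq> B \<Longrightarrow> M4 r s A \<subseteq> M4 r s B"
  by (auto simp: M1_def M4_def)

lemma rich_mono:
  assumes "rich R r s A" "A \<subseteq> B"
  shows "rich R r s B"
proof -
  have "\<And>x. x \<in> M1 r s A \<Longrightarrow> x \<in> M1 r s B" "\<And>x. x \<in> M4 r s A \<Longrightarrow> x \<in> M4 r s B"
    using class_mono[OF assms(2)] by blast+
  then show ?thesis using assms(1) unfolding rich_def by (elim disjE) blast+
qed

lemma unit_cong:
  assumes "U \<subseteq> A" "\<And>k. k \<in> A \<Longrightarrow> s k = s' k"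
  shows "unit r s U \<longleftrightarrow> unit r s' U"
proof -
  have eq: "\<forall>k\<in>U. s k = s' k" using assms by blast
  show ?thesis unfolding unit_def
    by (intro arg_cong2[where f = "(\<or>)"] ex_cong1) (use eq in auto)
qed

text \<open>Sizes are read off by list position, so appending an item yields a new size function
  that agrees with the old one only on the positions already filled.\<close>

lemma invariant_cong:
  assumes inv: "invariant R r s n B" and eq: "\<And>k. k < n \<Longrightarrow> s k = s' k"
  shows "invariant R r s' n B"
proof -
  have B: "B \<subseteq> {..<n}" using inv by (simp add: invariant_def)
  have eqB: "s k = s' k" if "k \<in> B" for k using that B eq by auto
  have sums: "sum s D = sum s' D" if "D \<subseteq> {..<n}" for D
    using that eq by (intro sum.cong) auto
  have M: "M1 r s D = M1 r s' D" "M4 r s D = M4 r s' D" if "D \<subseteq> {..<n}" for D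
    using that eq by (auto simp: M1_def M4_def)
  have adm: "admissible r s B \<longleftrightarrow> admissible r s' B"
    unfolding admissible_def using B sums by (metis subset_trans)
  have rich: "rich R r s B \<longleftrightarrow> rich R r s' B"
    unfolding rich_def M[OF B] using eqB by (simp add: M1_def cong: conj_cong)
  have u: "unit r s U \<longleftrightarrow> unit r s' U" if "U \<subseteq> {..<n}" for U
    by (rule unit_cong[OF that]) (simp add: eq)
  have u': "(\<exists>U\<subseteq>B. unit r s U \<and> sum s U \<le> w) \<longleftrightarrow> (\<exists>U\<subseteq>B. unit r s' U \<and> sum s' U \<le> w)" for w
    using u sums B by (metis subset_trans)
  have units: "(\<forall>V\<subseteq>{..<n}. unit r s V \<longrightarrow> (\<exists>U\<subseteq>B. unit r s U \<and> sum s U \<le> sum s V)) \<longleftrightarrow>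
      (\<forall>V\<subseteq>{..<n}. unit r s' V \<longrightarrow> (\<exists>U\<subseteq>B. unit r s' U \<and> sum s' U \<le> sum s' V))"
    unfolding u' using u sums by auto
  show ?thesis
    using inv unfolding invariant_def adm rich units M[OF subset_refl]
    by (simp add: eq eqB cong: conj_cong)
qed

section \<open>Numerical consequences of the range of the capacity\<close>

context
  fixes r R :: real
  \<comment> \<open>Polynomial forms of \<open>sqrt 2 / 2 \<le> r\<close> and
    \<open>r \<le> sqrt 3 - 1\<close>, which correspond to the two ends of the range of
    \<open>R\<close>.\<close>
  assumes r_pos: "0 < r" and r_lower: "1 / 2 \<le> r\<^sup>2" and r_upper: "r\<^sup>2 + 2 * r \<le> 2"
    and R_eq: "R = 4 * r\<^sup>2 - r"
begin

lemma r_ge: "7 / 10 \<le> r"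
proof (rule ccontr)
  assume "\<not> 7 / 10 \<le> r"
  then have "r * r < (7 / 10) * (7 / 10)" using r_pos by (intro mult_strict_mono) auto
  then show False using r_lower by (simp add: power2_eq_square)
qed

lemma r_le: "r \<le> 3 / 4"
proof (rule ccontr)
  assume a: "\<not> r \<le> 3 / 4"
  then have "(3 / 4) * (3 / 4) < r * r" by (intro mult_strict_mono) auto
  then show False using r_upper a by (simp add: power2_eq_square)
qed

lemma r_square_le: "r\<^sup>2 \<le> 3 / 4 * r"
  using r_le r_pos by (simp add: power2_eq_square)

lemma r_square_ge: "2 * r - 1 \<le> r\<^sup>2"
  using zero_le_power2[of "r - 1"] by (simp add: power2_eq_square algebra_simps)

lemma r_square_gt: "2 / 3 * r < r\<^sup>2"
  using r_ge r_pos by (simp add: power2_eq_square)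

text \<open>Serves to compare a lone packed item of size below \<open>r\<^sup>2\<close> with a
  retained item of size at least \<open>2 * r - 1\<close>; the difference of the two sides
  factors.\<close>

lemma r_cube_le: "r * r\<^sup>2 \<le> 2 * r - 1"
proof -
  have "0 \<le> (1 - r) * (r\<^sup>2 + r - 1)"
    using r_le r_ge r_lower by (intro mult_nonneg_nonneg) auto
  then show ?thesis by (simp add: power2_eq_square algebra_simps)
qed

section \<open>The possible buffers after each step\<close>

lemma L_iff: "k \<in> M1 r s C \<union> M2 r s C \<union> M3 r s C \<longleftrightarrow> k \<in> C \<and> 1 - r < s k \<and> s k < r\<^sup>2"
  using r_ge r_le r_lower by (auto simp: M1_def M2_def M3_def)

lemma M1_empty: "\<forall>x\<in>C. \<not> (1 - r < s x \<and> s x < r\<^sup>2) \<Longrightarrow> M1 r s C = {}"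
  using r_square_ge by (auto simp: M1_def)

text \<open>For a pair the bound amounts to \<open>r\<^sup>2 \<le> 2 * (1 - r)\<close>, which is
  exactly \<open>r_upper\<close>, that is, the upper end of the range of \<open>R\<close>.\<close>

lemma unit_ge: "unit r s U \<Longrightarrow> r\<^sup>2 \<le> sum s U"
  unfolding unit_def using r_upper by auto

lemma unit_le: "unit r s U \<Longrightarrow> sum s U \<le> 1"
  unfolding unit_def using r_le by auto

text \<open>In the cases \<open>pair\<close>, \<open>mixed\<close> and \<open>only4\<close> the
  buffer contains a lightest unit of \<open>C\<close>; in the other two cases \<open>C\<close>
  contains no unit at all. Whenever \<open>C\<close> has an item strictly between
  \<open>1 - r\<close> and \<open>r\<^sup>2\<close>, a smallest such item is kept.\<close>

lemma steps_abc:
  assumes steps: "step_a r s C {} Ba" "step_b r s C Ba Bb" "step_c r s C Bb Bc" and "finite C"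
  obtains
    (pair) a b where "a \<in> M1 r s C" "b \<in> M1 r s C" "a \<noteq> b" "Bc = {a, b}"
      "\<forall>x\<in>C. 1 - r < s x \<and> s x < r\<^sup>2 \<longrightarrow> s a \<le> s x" "\<forall>x\<in>M4 r s C. s a + s b \<le> s x"
      "\<forall>x\<in>M1 r s C. \<forall>y\<in>M1 r s C. x \<noteq> y \<longrightarrow> s a + s b \<le> s x + s y"
  | (mixed) a c where "a \<in> C" "1 - r < s a" "s a < r\<^sup>2" "c \<in> M4 r s C" "Bc = {a, c}"
      "\<forall>x\<in>C. 1 - r < s x \<and> s x < r\<^sup>2 \<longrightarrow> s a \<le> s x" "\<forall>x\<in>M4 r s C. s c \<le> s x"
      "\<forall>x\<in>M1 r s C. \<forall>y\<in>M1 r s C. x \<noteq> y \<longrightarrow> s c \<le> s x + s y"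
  | (only4) c where "\<forall>x\<in>C. \<not> (1 - r < s x \<and> s x < r\<^sup>2)" "c \<in> M4 r s C" "Bc = {c}"
      "\<forall>x\<in>M4 r s C. s c \<le> s x"
  | (single) a where "a \<in> C" "1 - r < s a" "s a < r\<^sup>2" "M4 r s C = {}" "Bc = {a}"
      "\<forall>x\<in>C. 1 - r < s x \<and> s x < r\<^sup>2 \<longrightarrow> s a \<le> s x" "\<forall>x\<in>M1 r s C. \<forall>y\<in>M1 r s C. x = y"
  | (none) "\<forall>x\<in>C. \<not> (1 - r < s x \<and> s x < r\<^sup>2)" "M4 r s C = {}" "Bc = {}"
proof -
  let ?L = "M1 r s C \<union> M2 r s C \<union> M3 r s C"
  have fin: "finite (M1 r s C)" "finite (M4 r s C)"
    using \<open>finite C\<close> by (simp_all add: M1_def M4_def)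
  have M1L: "1 - r < s x \<and> s x < r\<^sup>2" if "x \<in> M1 r s C" for x
    using that L_iff[of x s C] by blast
  have M1_card: "\<forall>x\<in>M1 r s C. \<forall>y\<in>M1 r s C. x = y" if "\<not> 2 \<le> card (M1 r s C)"
  proof -
    have "card (M1 r s C) \<le> 1" using that by simp
    then show ?thesis using card_le_Suc0_iff_eq[OF fin(1)] by simp
  qed
  show thesis
  proof (cases "?L = {}")
    case True
    then have L: "\<forall>x\<in>C. \<not> (1 - r < s x \<and> s x < r\<^sup>2)" and M1: "M1 r s C = {}"
      using L_iff by blast+
    have "Ba = {}" using steps(1) True by (simp add: step_a_def)
    then have "Bb = {}" using steps(2) M1 by (simp add: step_b_def)
    then have c: "step_c r s C {} Bc" using steps(3) by simp
    show thesis
    proof (cases "M4 r s C = {}")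
      case True
      then show thesis using none L c by (simp add: step_c_def)
    next
      case False
      then have "M4 r s C \<noteq> {} \<and> card (M1 r s {}) \<le> 1" by (simp add: M1_def)
      then obtain c where "is_arg_min s (\<lambda>x. x \<in> M4 r s C) c" "Bc = {c}"
        using c unfolding step_c_def by (auto split: if_splits)
      then show thesis using only4[OF L] is_arg_minD by blast
    qed
  next
    case False
    then obtain a where a: "is_arg_min s (\<lambda>x. x \<in> ?L) a" "Ba = {a}"
      using steps(1) unfolding step_a_def by auto
    have aL: "a \<in> C" "1 - r < s a" "s a < r\<^sup>2"
      using is_arg_minD[OF a(1)] L_iff by blast+
    have amin: "\<forall>x\<in>C. 1 - r < s x \<and> s x < r\<^sup>2 \<longrightarrow> s a \<le> s x"
      using is_arg_minD[OF a(1)] L_iff by blast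
    have M1a: "card (M1 r s {a}) \<le> 1"
      using card_mono[of "{a}" "M1 r s {a}"] class_subsets(1) by simp
    show thesis
    proof (cases "card (M1 r s C) \<ge> 2")
      case True
      then obtain b where b: "is_arg_min s (\<lambda>x. x \<in> M1 r s C - {a}) b"
        and Bb: "Bb = (if M4 r s C = {} \<or> s a + s b \<le> Min (s ` M4 r s C) then insert b {a} else {a})"
        using steps(2) unfolding step_b_def a(2) by auto
      have b': "b \<in> M1 r s C" "b \<noteq> a" "\<forall>x\<in>M1 r s C - {a}. s b \<le> s x"
        using is_arg_minD[OF b] by auto
      \<comment> \<open>The item \<open>a\<close> is no larger than \<open>b\<close>, which lies in
        \<open>M1\<close>.\<close>
      have a1: "a \<in> M1 r s C"
        using aL amin b' M1L[OF b'(1)] by (force simp: M1_def)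
      have ab: "\<forall>x\<in>M1 r s C. \<forall>y\<in>M1 r s C. x \<noteq> y \<longrightarrow> s a + s b \<le> s x + s y"
        using le_sum_pair[of "M1 r s C" s a b] amin b' M1L class_subsets(1) by blast
      show thesis
      proof (cases "M4 r s C = {} \<or> s a + s b \<le> Min (s ` M4 r s C)")
        case True
        then have Bb': "Bb = {a, b}" using Bb by auto
        have "M1 r s {a, b} = {a, b}" using a1 b' by (auto simp: M1_def)
        then have Bc: "Bc = {a, b}" using steps(3) b' unfolding step_c_def Bb' by simp
        have "\<forall>x\<in>M4 r s C. s a + s b \<le> s x"
          using True fin by (metis Min_le finite_imageI imageI empty_iff order_trans)
        then show thesis by (rule pair[OF a1 b'(1) b'(2)[symmetric] Bc amin _ ab])
      next
        case F: False
        then have Bb': "Bb = {a}" using Bb by simp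
        obtain c where c: "is_arg_min s (\<lambda>x. x \<in> M4 r s C) c" "Bc = {c, a}"
          using steps(3) F M1a unfolding step_c_def Bb' by auto
        have c': "c \<in> M4 r s C" "\<forall>x\<in>M4 r s C. s c \<le> s x" using is_arg_minD[OF c(1)] by auto
        \<comment> \<open>Step (b) rejected \<open>b\<close> because some \<open>M4\<close> item is
          lighter than the lightest \<open>M1\<close> pair; therefore the smallest \<open>M4\<close>
          item is a lightest unit.\<close>
        have "Min (s ` M4 r s C) \<in> s ` M4 r s C" using F fin by (intro Min_in) auto
        then have "s c < s a + s b" using F c' by auto
        then have "\<forall>x\<in>M1 r s C. \<forall>y\<in>M1 r s C. x \<noteq> y \<longrightarrow> s c \<le> s x + s y"
          using ab by force
        moreover have "Bc = {a, c}" using c(2) by blast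
        ultimately show thesis by (intro mixed[OF aL c'(1) _ amin c'(2)])
      qed
    next
      case F: False
      then have Bb: "Bb = {a}" using steps(2) a unfolding step_b_def by simp
      note one = M1_card[OF F]
      show thesis
      proof (cases "M4 r s C = {}")
        case True
        then have "Bc = {a}" using steps(3) Bb by (simp add: step_c_def)
        then show thesis by (rule single[OF aL True _ amin one])
      next
        case False
        obtain c where c: "is_arg_min s (\<lambda>x. x \<in> M4 r s C) c" "Bc = {c, a}"
          using steps(3) False M1a unfolding step_c_def Bb by auto
        have c': "c \<in> M4 r s C" "\<forall>x\<in>M4 r s C. s c \<le> s x" using is_arg_minD[OF c(1)] by auto
        have "Bc = {a, c}" using c(2) by blast
        then show thesis by (rule mixed[OF aL c'(1) _ amin c'(2)]) (use one in blast)
      qed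
    qed
  qed
qed

text \<open>The guard of step (d), apart from the existence of a candidate. It is evaluated below
  for each shape of buffer that steps (a) to (c) can leave.\<close>

definition trigger :: "(nat \<Rightarrow> real) \<Rightarrow> nat set \<Rightarrow> bool" where
  "trigger s B \<longleftrightarrow>
     (card (M1 r s B) = 2 \<and> sum s (M1 r s B) \<le> R - r) \<or>
     (card (M4 r s B) = 1 \<and> sum s (M4 r s B) \<le> R - r)"

lemma trigger_pair:
  assumes "p \<in> M1 r s C" "q \<in> M1 r s C" "p \<noteq> q"
  shows "trigger s {p, q} \<longleftrightarrow> s p + s q \<le> R - r"
proof -
  have "M1 r s {p, q} = {p, q}" "M4 r s {p, q} = {}"
    using assms r_square_ge by (auto simp: M1_def M4_def)
  then show ?thesis using assms by (simp add: trigger_def)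
qed

lemma trigger_mixed:
  assumes "s a < r\<^sup>2" "c \<in> M4 r s C"
  shows "trigger s {a, c} \<longleftrightarrow> s c \<le> R - r"
proof -
  have "M1 r s {a, c} \<subseteq> {a}" "M4 r s {a, c} = {c}"
    using assms r_square_ge by (auto simp: M1_def M4_def)
  moreover from this have "card (M1 r s {a, c}) \<le> 1"
    using card_mono[of "{a}"] by fastforce
  ultimately show ?thesis by (simp add: trigger_def)
qed

lemma trigger_single4:
  assumes "c \<in> M4 r s C"
  shows "trigger s {c} \<longleftrightarrow> s c \<le> R - r"
proof -
  have "M1 r s {c} = {}" "M4 r s {c} = {c}"
    using assms r_square_ge by (auto simp: M1_def M4_def)
  then show ?thesis by (simp add: trigger_def)
qed

lemma not_trigger_single:
  assumes "s a < r\<^sup>2"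
  shows "\<not> trigger s {a}"
proof -
  have "M4 r s {a} = {}" using assms by (auto simp: M4_def)
  moreover have "card (M1 r s {a}) \<le> 1"
    using card_mono[of "{a}" "M1 r s {a}"] class_subsets(1) by simp
  ultimately show ?thesis by (simp add: trigger_def)
qed

lemma not_trigger_empty: "\<not> trigger s {}"
  by (simp add: trigger_def M1_def M4_def)

text \<open>All sizes are below \<open>r\<close>, so the four classes exhaust the non-small items.
  In the case \<open>same\<close> with the guard satisfied, there was no candidate, so every
  non-small item of \<open>C\<close> is already in the buffer.\<close>

lemma step_d_cases:
  assumes step: "step_d R r s C B B'" and less: "\<forall>k\<in>C. s k < r"
  obtains
    (add) d where "trigger s B" "d \<in> C - B" "1 - r < s d" "s d < r" "sum s B + s d \<le> R"
      "B' = insert d B"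
  | (full) d where "d \<in> C - B" "s d < r" "R < sum s B + s d" "B' = B"
  | (same) "B' = B" "trigger s B \<Longrightarrow> \<forall>x\<in>C. 1 - r < s x \<longrightarrow> x \<in> B"
proof -
  define A where "A = M1 r s C \<union> M2 r s C \<union> M3 r s C \<union> M4 r s C - B"
  have A: "x \<in> A \<longleftrightarrow> x \<in> C \<and> x \<notin> B \<and> 1 - r < s x" for x
    using less L_iff[of x s C] r_upper r_le r_lower unfolding A_def by (auto simp: M4_def)
  have iff: "step_d R r s C B B' \<longleftrightarrow>
     (if trigger s B \<and> A \<noteq> {}
      then \<exists>a. is_arg_min s (\<lambda>x. x \<in> A) a \<and>
             B' = (if sum s B + s a \<le> R then insert a B else B)
      else B' = B)"
    unfolding step_d_def Let_def A_def trigger_def ..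
  show thesis
  proof (cases "trigger s B \<and> A \<noteq> {}")
    case True
    then obtain d where d: "is_arg_min s (\<lambda>x. x \<in> A) d"
      "B' = (if sum s B + s d \<le> R then insert d B else B)"
      using step unfolding iff by auto
    have "d \<in> A" using d(1) by (rule is_arg_min_memD)
    then show thesis using True A less d(2) add[of d] full[of d] by (auto split: if_splits)
  next
    case False
    then have "B' = B" using step unfolding iff by simp
    then show thesis using same False A by blast
  qed
qed

text \<open>A device for bounding the buffer: if its non-small items split into \<open>X\<close> and
  a packing \<open>Y\<close>, then \<open>Y\<close> together with all small items stays below
  \<open>r\<close>, and it suffices that \<open>X\<close> has size at most
  \<open>R - r\<close>.\<close>

lemma sum_insert_small_le:
  assumes C: "admissible r s C" "finite C" "\<forall>k\<in>C. 0 < s k"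
    and "X \<subseteq> C" "Y \<subseteq> C" "sum s Y \<le> 1"
  shows "sum s (X \<union> Y \<union> small r s C) \<le> sum s X + r"
proof -
  have fin: "finite X" "finite (Y \<union> small r s C)"
    using assms class_subsets(5)[of r s C] by (auto intro: finite_subset)
  have "sum s (X \<union> (Y \<union> small r s C)) \<le> sum s X + sum s (Y \<union> small r s C)"
    using sum_Un[OF fin, of s] sum_nonneg[of "X \<inter> (Y \<union> small r s C)" s] assms
    by (auto simp: subset_iff less_imp_le)
  also have "\<dots> \<le> sum s X + r"
    using admissible_add_small[OF C(1,2) assms(5,6)] by simp
  finally show ?thesis by (simp add: Un_assoc)
qed

lemma r_square_add_le_R: "r\<^sup>2 + r \<le> R"
  using r_square_gt unfolding R_eq by simp

lemma R_less: "R < 1 + r\<^sup>2"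
  using r_square_le r_le unfolding R_eq by linarith

lemma M1_D: "p \<in> M1 r s C \<Longrightarrow> p \<in> C \<and> 1 - r < s p \<and> s p < 2 * r - 1"
  by (simp add: M1_def)

lemma M4_D: "p \<in> M4 r s C \<Longrightarrow> p \<in> C \<and> r\<^sup>2 \<le> s p \<and> s p < r"
  by (simp add: M4_def)

section \<open>One round in which no packing has size in [r, 1]\<close>

context
  fixes s :: "nat \<Rightarrow> real" and C Ba Bb Bc Bd B' :: "nat set"
  assumes steps: "step_a r s C {} Ba" "step_b r s C Ba Bb" "step_c r s C Bb Bc"
      "step_d R r s C Bc Bd" "step_e r s C Bd B'"
    and C: "finite C" "admissible r s C" "\<forall>k\<in>C. 0 < s k" "\<forall>k\<in>C. s k < r"
begin

lemma step_d_mono: "Bc \<subseteq> Bd"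
  by (cases rule: step_d_cases[OF steps(4) C(4)]) auto

lemma step_de_mono: "Bc \<subseteq> B'"
  using step_d_mono steps(5) unfolding step_e_def by blast

text \<open>Step (e) adds the small items without checking the capacity. In every case the non-small
  items split into a set of size at most \<open>R - r\<close> and a packing; when step (d) adds an
  item, its guard shows that the unit can serve as the first set.\<close>

lemma round_size: "sum s B' \<le> R"
proof -
  have B': "B' = Bd \<union> small r s C" using steps(5) by (simp add: step_e_def)
  have bound: "sum s B' \<le> R" if "Bd = X \<union> Y" "X \<subseteq> C" "Y \<subseteq> C" "sum s Y \<le> 1" "sum s X \<le> R - r" for X Y
    using sum_insert_small_le[OF C(2,1,3) that(2-4)] that(1,5) unfolding B' by simp
  have R: "r \<le> R" using r_square_add_le_R r_lower by simp
  show ?thesis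
    using steps(1-3) C(1)
  proof (cases rule: steps_abc)
    case (pair a b)
    note ab = M1_D[OF pair(1)] M1_D[OF pair(2)]
    show ?thesis
    using steps(4) C(4)
    proof (cases rule: step_d_cases)
      case (add d)
      then show ?thesis
        using bound[of "{a, b}" "{d}"] ab pair(3,4) trigger_pair[OF pair(1-3)] r_le by auto
    qed (use bound[of "{}" "{a, b}"] ab pair(3,4) r_le R in auto)
  next
    case (mixed a c)
    note c = M4_D[OF mixed(4)]
    have ac: "a \<noteq> c" using mixed(3) c by auto
    \<comment> \<open>Here the first set is \<open>{a}\<close>, since
      \<open>s a < r\<^sup>2 \<le> R - r\<close>.\<close>
    have same: ?thesis if "Bd = Bc"
      using bound[of "{a}" "{c}"] that mixed(1,3,5) c r_le r_square_add_le_R by auto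
    show ?thesis
    using steps(4) C(4)
    proof (cases rule: step_d_cases)
      case (add d)
      have d: "d \<noteq> a" "d \<noteq> c" using add mixed(5) by auto
      have sc: "s c \<le> R - r" using add(1) trigger_mixed[OF mixed(3,4)] mixed(5) by simp
      have "s a + s c + s d \<le> R" using add(5) mixed(5) ac by simp
      \<comment> \<open>Step (d) checked the total against \<open>R\<close>, and \<open>c\<close>
        accounts for at least \<open>r\<^sup>2 > R - 1\<close> of it.\<close>
      then have "s a + s d \<le> 1" using c R_less by linarith
      then show ?thesis
        using bound[of "{c}" "{a, d}"] sc add(2,6) mixed(1,5) c d by auto
    qed (use same in auto)
  next
    case (only4 c)
    note c = M4_D[OF only4(2)]
    show ?thesis
    using steps(4) C(4)
    proof (cases rule: step_d_cases)
      case (add d)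
      then show ?thesis
        using bound[of "{c}" "{d}"] c only4(3) trigger_single4[OF only4(2)] r_le by auto
    qed (use bound[of "{}" "{c}"] c only4(3) r_le R in auto)
  next
    case (single a)
    have "Bd = Bc"
      using not_trigger_single[of s a] single(3) single(5)
      by (cases rule: step_d_cases[OF steps(4) C(4)]) auto
    then show ?thesis
      using bound[of "{}" "{a}"] single(1,5) C(4) r_le R by fastforce
  next
    case none
    have "Bd = Bc"
      using not_trigger_empty none(3) by (cases rule: step_d_cases[OF steps(4) C(4)]) auto
    then show ?thesis using bound[of "{}" "{}"] none(3) R by simp
  qed
qed

lemma round_min:
  assumes "x \<in> C" "1 - r < s x" "s x < r\<^sup>2"
  shows "\<exists>a\<in>B'. 1 - r < s a \<and> s a < r\<^sup>2 \<and> (\<forall>y\<in>C. 1 - r < s y \<longrightarrow> s a \<le> s y)"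
proof -
  have "\<exists>a\<in>Bc. 1 - r < s a \<and> s a < r\<^sup>2 \<and> (\<forall>y\<in>C. 1 - r < s y \<and> s y < r\<^sup>2 \<longrightarrow> s a \<le> s y)"
    using steps(1-3) C(1)
  proof (cases rule: steps_abc)
    case (pair a b)
    then show ?thesis using M1_D[OF pair(1)] r_square_ge by auto
  qed (use assms in auto)
  then obtain a where a: "a \<in> Bc" "1 - r < s a" "s a < r\<^sup>2"
    "\<forall>y\<in>C. 1 - r < s y \<and> s y < r\<^sup>2 \<longrightarrow> s a \<le> s y" by blast
  \<comment> \<open>Items of size at least \<open>r\<^sup>2\<close> are larger than \<open>a\<close>
    anyway.\<close>
  then have "\<forall>y\<in>C. 1 - r < s y \<longrightarrow> s a \<le> s y" by force
  then show ?thesis using a step_de_mono by blast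
qed

lemma round_unit:
  assumes "V \<subseteq> C" "unit r s V"
  shows "\<exists>U\<subseteq>B'. unit r s U \<and> sum s U \<le> sum s V"
proof -
  have V: "(\<exists>x\<in>M4 r s C. sum s V = s x) \<or>
      (\<exists>x\<in>M1 r s C. \<exists>y\<in>M1 r s C. x \<noteq> y \<and> sum s V = s x + s y)"
    using assms unfolding unit_def M1_def M4_def by fastforce
  have "\<exists>U\<subseteq>Bc. unit r s U \<and> sum s U \<le> sum s V"
    using steps(1-3) C(1)
  proof (cases rule: steps_abc)
    case (pair a b)
    have "unit r s {a, b}" using pair(1-3) M1_D unfolding unit_def by blast
    moreover have "s a + s b \<le> sum s V" using V pair by auto
    ultimately show ?thesis using pair(3,4) by (intro exI[of _ "{a, b}"]) simp
  next
    case (mixed a c)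
    have "unit r s {c}" using mixed(4) M4_D unfolding unit_def by blast
    moreover have "s c \<le> sum s V" using V mixed by auto
    ultimately show ?thesis using mixed(5) by (intro exI[of _ "{c}"]) simp
  next
    case (only4 c)
    have "unit r s {c}" using only4(2) M4_D unfolding unit_def by blast
    moreover have "s c \<le> sum s V" using V M1_empty[OF only4(1)] only4(4) by auto
    ultimately show ?thesis using only4(3) by (intro exI[of _ "{c}"]) simp
  next
    case (single a)
    then show ?thesis using V by auto
  next
    case none
    then show ?thesis using V M1_empty[OF none(1)] by auto
  qed
  then show ?thesis using step_de_mono by blast
qed

text \<open>With no sizes between \<open>2 * r - 1\<close> and \<open>r\<^sup>2\<close>, an item
  that step (d) adds to an \<open>M1\<close> pair is either a third \<open>M1\<close> item or an
  \<open>M4\<close> item, and both make the buffer rich. The second claim says that richness is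
  never lost.\<close>

lemma round_rich:
  assumes no_M23: "\<forall>x\<in>C. 1 - r < s x \<longrightarrow> s x < 2 * r - 1 \<or> r\<^sup>2 \<le> s x"
  shows "M1 r s C \<subseteq> B' \<or> rich R r s B'" and "rich R r s C \<Longrightarrow> rich R r s B'"
proof -
  have Bd: "Bd \<subseteq> B'" using steps(5) by (auto simp: step_e_def)
  \<comment> \<open>This dichotomy yields both claims: in its first alternative the premise of the
    second claim fails.\<close>
  have "(M1 r s C \<subseteq> Bd \<and> \<not> rich R r s C) \<or> rich R r s Bd"
    using steps(1-3) C(1)
  proof (cases rule: steps_abc)
    case (pair a b)
    note ab = M1_D[OF pair(1)] M1_D[OF pair(2)]
    have ab_lt: "s a + s b < r" using admissible_pair[OF C(2)] ab pair(3) r_le by simp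
    show ?thesis
    proof (cases "R - r \<le> s a + s b")
      case True
      then have "rich R r s Bc" using pair(1-4) unfolding rich_def by (auto simp: M1_def)
      then show ?thesis using rich_mono[OF _ step_d_mono] by blast
    next
      case F: False
      show ?thesis
      using steps(4) C(4)
    proof (cases rule: step_d_cases)
        case (add d)
        then have "d \<noteq> a" "d \<noteq> b" using pair(4) by auto
        moreover have "s d < 2 * r - 1 \<or> r\<^sup>2 \<le> s d" using no_M23 add by blast
        ultimately have "rich R r s Bd"
          using ab pair(3,4) add(3,4,6) unfolding rich_def by (auto simp: M1_def M4_def)
        then show ?thesis by blast
      next
        case (full d)
        \<comment> \<open>Impossible: the pair is lighter than \<open>R - r\<close> and
          \<open>d\<close> is lighter than \<open>r\<close>, so \<open>d\<close> would have
          fitted.\<close>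
        then show ?thesis using F pair(3,4) by simp
      next
        case same
        then have "\<forall>x\<in>C. 1 - r < s x \<longrightarrow> x = a \<or> x = b"
          using F trigger_pair[OF pair(1-3)] pair(4) by auto
        then have M1: "M1 r s C \<subseteq> {a, b}" and "M4 r s C = {}"
          using ab r_square_ge r_lower r_le by (auto simp: M1_def M4_def)
        then have "x = a \<or> x = b" if "x \<in> M1 r s C" for x using that by blast
        then have "\<not> rich R r s C"
          using F \<open>M4 r s C = {}\<close> unfolding rich_def by (metis add.commute)
        then show ?thesis using M1 same pair(4) by simp
      qed
    qed
  next
    case (mixed a c)
    then have "rich R r s Bc" unfolding rich_def by (auto simp: M4_def)
    then show ?thesis using rich_mono[OF _ step_d_mono] by blast
  next
    case (only4 c)
    then have "rich R r s Bc" unfolding rich_def by (auto simp: M4_def)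
    then show ?thesis using rich_mono[OF _ step_d_mono] by blast
  next
    case (single a)
    have "Bd = Bc"
      using not_trigger_single[of s a] single(3) single(5)
      by (cases rule: step_d_cases[OF steps(4) C(4)]) auto
    moreover have "\<not> rich R r s C" using single(4,7) unfolding rich_def by blast
    moreover have "M1 r s C \<subseteq> {a}"
    proof
      fix x assume x: "x \<in> M1 r s C"
      then have "1 - r < s x" "s x < 2 * r - 1" "x \<in> C" using M1_D by auto
      moreover from this have "s a \<le> s x" using single(6) r_square_ge by auto
      ultimately have "a \<in> M1 r s C" using single(1,2) by (simp add: M1_def)
      then show "x \<in> {a}" using x single(7) by blast
    qed
    ultimately show ?thesis using single(5) by blast
  next
    case none
    then show ?thesis using M1_empty[OF none(1)] by (simp add: rich_def)
  qed
  moreover have "rich R r s B'" if "rich R r s Bd" using that Bd by (rule rich_mono)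
  ultimately show "M1 r s C \<subseteq> B' \<or> rich R r s B'" and "rich R r s C \<Longrightarrow> rich R r s B'"
    using Bd by auto
qed

end

section \<open>Preservation of the invariant\<close>

lemma invariant_step:
  assumes inv: "invariant R r s n B"
    and steps: "step_a r s (insert n B) {} Ba" "step_b r s (insert n B) Ba Bb"
      "step_c r s (insert n B) Bb Bc" "step_d R r s (insert n B) Bc Bd" "step_e r s (insert n B) Bd B'"
    and adm: "admissible r s (insert n B)" and n: "0 < s n" "s n \<le> 1"
  shows "invariant R r s (Suc n) B'"
proof -
  define C where "C = insert n B"
  note steps = steps[folded C_def] and adm = adm[folded C_def]
  note D = invariantD[OF inv]
  note B = D(1) and pos = D(2) and small = D(3) and least = D(5)[rule_format]
    and pairs = D(6)[rule_format] and triples = D(7)[rule_format]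
    and units = D(8)[rule_format] and M1 = D(9)
  have nB: "n \<notin> B" and finB: "finite B" using B finite_subset by auto
  have BC: "B \<subseteq> C" and nC: "n \<in> C" and CS: "C \<subseteq> {..<Suc n}" using B by (auto simp: C_def)
  have finC: "finite C" using finB by (simp add: C_def)
  have n_less: "s n < r" using admissible_less[of r s C n] adm nC n by simp
  have posS: "\<forall>k<Suc n. 0 < s k \<and> s k < r" using pos n n_less by (simp add: less_Suc_eq)
  have posC: "\<forall>k\<in>C. 0 < s k" "\<forall>k\<in>C. s k < r" using posS CS by auto
  note round = round_size[OF steps finC adm posC] round_min[OF steps finC adm posC]
    round_unit[OF steps finC adm posC] round_rich[OF steps finC adm posC]

  have B': "B' \<subseteq> C"
    using step_a_subset[OF steps(1)] step_b_subset[OF steps(2)] step_c_subset[OF steps(3)]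
      step_d_subset[OF steps(4)] steps(5) class_subsets(5)[of r s C] unfolding step_e_def by blast
  \<comment> \<open>A non-small \<open>n\<close> packed with a retained unit would give size above
    \<open>r\<^sup>2 + (1 - r) \<ge> r\<close>, against admissibility.\<close>
  have unit_add: False if U: "U \<subseteq> B" "unit r s U" and le: "sum s U + s n \<le> 1" and "1 - r < s n" for U
  proof -
    have "n \<notin> U" "finite U" using U(1) nB finB finite_subset by auto
    then have "sum s (insert n U) = s n + sum s U" by simp
    then have "s n + sum s U < r"
      using admissibleD[OF adm, of "insert n U"] U(1) BC nC le by auto
    then show False using unit_ge[OF U(2)] r_square_ge that(4) by linarith
  qed
  \<comment> \<open>Since \<open>y\<close> may have been discarded, a retained stand-in of at most
    its size is used: a unit if \<open>s y\<close> is at least \<open>r\<^sup>2\<close>, the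
    smallest non-small item otherwise.\<close>
  have pair_new: "s y < 2 * r - 1 \<and> s n < 2 * r - 1"
    if y: "y < n" "1 - r < s y" and sn: "1 - r < s n" and le: "s y + s n \<le> 1" for y
  proof (cases "r\<^sup>2 \<le> s y")
    case True
    then have "unit r s {y}" using pos y unfolding unit_def by blast
    then obtain U where "U \<subseteq> B" "unit r s U" "sum s U \<le> s y"
      using units[of "{y}"] y by auto
    then show ?thesis using unit_add[of U] sn le by force
  next
    case False
    then obtain a where a: "a \<in> B" "1 - r < s a" "s a \<le> s y"
      using least[OF y] y by force
    have "s a + s n < r"
      using admissible_pair[OF adm, of a n] a nB BC nC le by auto
    \<comment> \<open>Each summand exceeds \<open>1 - r\<close>, so the other is below
      \<open>r - (1 - r)\<close>.\<close>
    then have sa: "s a < 2 * r - 1" and sn': "s n < 2 * r - 1" using a sn by auto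
    have "s y < 2 * r - 1"
    proof (cases "y = a")
      case F: False
      \<comment> \<open>Back from the stand-in to \<open>y\<close>: as
        \<open>(2 * r - 1) + r\<^sup>2 \<le> 1\<close>, the old clause on pairs applies to
        \<open>a\<close> and \<open>y\<close>.\<close>
      have "s a + s y \<le> 1" using sa False r_upper by simp
      then show ?thesis using pairs[of a y] F a y B by auto
    qed (use sa in simp)
    then show ?thesis using sn' by simp
  qed
  have pairsS: "s x < 2 * r - 1 \<and> s y < 2 * r - 1"
    if xy: "x < Suc n" "y < Suc n" "x \<noteq> y" "1 - r < s x" "1 - r < s y" "s x + s y \<le> 1" for x y
  proof -
    consider "x = n" "y < n" | "y = n" "x < n" | "x < n" "y < n"
      using xy(1-3) by (auto simp: less_Suc_eq)
    then show ?thesis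
    proof cases
      case 1
      then show ?thesis using pair_new[of y] xy by (simp add: add.commute)
    next
      case 2
      then show ?thesis using pair_new[of x] xy by simp
    next
      case 3
      then show ?thesis using pairs[of x y] xy by simp
    qed
  qed
  have triple_new: "1 < s x + s y + s n"
    if "x < n" "y < n" "x \<noteq> y" "1 - r < s x" "1 - r < s y" "1 - r < s n" for x y
  proof (rule ccontr)
    assume "\<not> 1 < s x + s y + s n"
    then have le: "s x + s y + s n \<le> 1" by simp
    then have "s x < 2 * r - 1 \<and> s y < 2 * r - 1" using pairs[of x y] that n by simp
    \<comment> \<open>The two old items form a unit, so a retained unit no larger than it would fit
      together with \<open>n\<close>.\<close>
    then have "unit r s {x, y}" using that unfolding unit_def by blast
    then have "\<exists>U\<subseteq>B. unit r s U \<and> sum s U \<le> s x + s y"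
      using units[of "{x, y}"] that(1-3) by simp
    then obtain U where U: "U \<subseteq> B" "unit r s U" "sum s U \<le> s x + s y" by blast
    have "sum s U + s n \<le> 1" using U(3) le by linarith
    then show False using unit_add[OF U(1,2)] that(6) by blast
  qed
  have triplesS: "1 < s x + s y + s z"
    if xyz: "x < Suc n" "y < Suc n" "z < Suc n" "x \<noteq> y" "x \<noteq> z" "y \<noteq> z"
      "1 - r < s x" "1 - r < s y" "1 - r < s z" for x y z
  proof -
    consider "x = n" | "y = n" | "z = n" | "x < n" "y < n" "z < n"
      using xyz by (auto simp: less_Suc_eq)
    then show ?thesis
    proof cases
      case 1
      then show ?thesis using triple_new[of y z] xyz by simp
    next
      case 2
      then show ?thesis using triple_new[of x z] xyz by simp
    next
      case 3
      then show ?thesis using triple_new[of x y] xyz by simp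
    next
      case 4
      then show ?thesis using triples[of x y z] xyz by simp
    qed
  qed
  have old: "\<exists>a\<in>C. 1 - r < s a \<and> s a \<le> s x \<and> s a < r\<^sup>2 \<and>
      (\<forall>y<n. y \<noteq> a \<and> 1 - r < s y \<and> s y < 2 * r - 1 \<longrightarrow> s a + s y < r)"
    if x: "x < n" "1 - r < s x" "s x < r\<^sup>2" for x
    using least[OF x] x BC by force
  have leastS: "\<exists>a\<in>B'. 1 - r < s a \<and> (\<forall>y<Suc n. 1 - r < s y \<longrightarrow> s a \<le> s y) \<and>
           (\<forall>y<Suc n. y \<noteq> a \<and> 1 - r < s y \<and> s y < 2 * r - 1 \<longrightarrow> s a + s y < r)"
    if x: "x < Suc n" "1 - r < s x" "s x < r\<^sup>2" for x
  proof -
    obtain x' where "x' \<in> C" "1 - r < s x'" "s x' < r\<^sup>2"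
    proof (cases "x = n")
      case True
      then show thesis using that x nC by blast
    next
      case False
      then have "x < n" using x by simp
      then show thesis using old[of x] that x by blast
    qed
    then obtain a where a: "a \<in> B'" "1 - r < s a" "s a < r\<^sup>2"
      "\<And>y. y \<in> C \<Longrightarrow> 1 - r < s y \<Longrightarrow> s a \<le> s y"
      using round(2)[of x'] by blast
    have aC: "a \<in> C" using a(1) B' by blast
    have near: "s a + s y < r" if "y \<in> C" "y \<noteq> a" "1 - r < s y" "s y < 2 * r - 1" for y
      using admissible_pair[OF adm aC that(1)] that a(4)[OF that(1,3)] r_le by simp
    have "s a \<le> s y" if y: "y < Suc n" "1 - r < s y" for y
    proof (cases "r\<^sup>2 \<le> s y")
      case False
      then show ?thesis
      proof (cases "y = n")
        case F: False
        then obtain a' where "a' \<in> C" "1 - r < s a'" "s a' \<le> s y"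
          using old[of y] y False by auto
        then show ?thesis using a(4)[of a'] by simp
      qed (use a(4)[OF nC] y in simp)
    qed (use a in simp)
    moreover have "s a + s y < r"
      if y: "y < Suc n" "y \<noteq> a" "1 - r < s y" "s y < 2 * r - 1" for y
    \<comment> \<open>For \<open>y\<close> outside \<open>C\<close> the bound is inherited from the
      item \<open>a'\<close> of the old invariant: \<open>a'\<close> lies in \<open>C\<close>, so it
      differs from \<open>y\<close>, and it is at least as large as \<open>a\<close>.\<close>
    proof (cases "y \<in> C")
      case False
      then have "y < n" using y nC by (cases "y = n") auto
      then obtain a' where a': "a' \<in> C" "1 - r < s a'"
        "\<forall>y<n. y \<noteq> a' \<and> 1 - r < s y \<and> s y < 2 * r - 1 \<longrightarrow> s a' + s y < r"
        using old[of y] y r_square_ge by auto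
      then have "s a' + s y < r" using \<open>y < n\<close> y False by blast
      then show ?thesis using a(4)[OF a'(1,2)] by simp
    qed (use near y in simp)
    ultimately show ?thesis using a(1,2) by blast
  qed
  have unitsS: "\<exists>U\<subseteq>B'. unit r s U \<and> sum s U \<le> sum s V"
    if V: "V \<subseteq> {..<Suc n}" "unit r s V" for V
  proof -
    \<comment> \<open>Parts of \<open>V\<close> may have been discarded, so \<open>V\<close> is
      first replaced by a unit inside \<open>C\<close>.\<close>
    have "\<exists>W\<subseteq>C. unit r s W \<and> sum s W \<le> sum s V"
    proof (cases "n \<in> V")
      case False
      then have "V \<subseteq> {..<n}" using V(1) by (auto simp: less_Suc_eq)
      then show ?thesis using units[OF _ V(2)] BC by blast
    next
      case nV: True
      show ?thesis
      proof (cases "V \<subseteq> C")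
        case False
        then have "V \<noteq> {n}" using nC by auto
        then obtain q where q: "V = {n, q}" "q \<noteq> n" "1 - r < s q" "s q < 2 * r - 1"
          "1 - r < s n" "s n < 2 * r - 1"
          using V(2) nV unfolding unit_def by fastforce
        then have "q < n" using V(1) by auto
        \<comment> \<open>The missing partner \<open>q\<close> of \<open>n\<close> is exchanged for
          the retained smallest item, which lies in \<open>M1\<close> because
          \<open>s a \<le> s q\<close>.\<close>
        then obtain a where a: "a \<in> B" "1 - r < s a" "s a \<le> s q"
          using least[of q] q r_square_ge by force
        then have "a \<noteq> n" using nB by blast
        then have "unit r s {n, a}" using a q unfolding unit_def by force
        moreover have "sum s {n, a} \<le> sum s V" using q(1,2) a \<open>a \<noteq> n\<close> by simp
        moreover have "{n, a} \<subseteq> C" using a(1) BC nC by blast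
        ultimately show ?thesis by (intro exI[of _ "{n, a}"]) simp
      qed (use V in blast)
    qed
    then obtain W where W: "W \<subseteq> C" "unit r s W" "sum s W \<le> sum s V" by blast
    obtain U where "U \<subseteq> B'" "unit r s U" "sum s U \<le> sum s W" using round(3)[OF W(1,2)] by blast
    then show ?thesis using W(3) by (intro exI[of _ U]) simp
  qed
  have M1S: "M1 r s {..<Suc n} \<subseteq> B' \<or> rich R r s B'"
  proof (cases "M1 r s {..<Suc n} = {}")
    case False
    then obtain x where x: "x < Suc n" "1 - r < s x" "s x < 2 * r - 1"
      by (auto simp: M1_def)
    \<comment> \<open>Once an \<open>M1\<close> item \<open>x\<close> has been seen, a
      \<open>y\<close> with size from \<open>2 * r - 1\<close> up to below \<open>r\<^sup>2\<close>
      would satisfy \<open>s x + s y \<le> 1\<close> without being in \<open>M1\<close>, against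
      \<open>pairsS\<close>.\<close>
    have "\<forall>y\<in>C. 1 - r < s y \<longrightarrow> s y < 2 * r - 1 \<or> r\<^sup>2 \<le> s y"
    proof (intro ballI impI)
      fix y assume y: "y \<in> C" "1 - r < s y"
      then have "y < Suc n" using CS by auto
      then show "s y < 2 * r - 1 \<or> r\<^sup>2 \<le> s y"
        using pairsS[of x y] x y r_upper by (cases "x = y") auto
    qed
    note rich = round(4,5)[OF this]
    show ?thesis using M1
    proof
      assume "M1 r s {..<n} \<subseteq> B"
      then have "M1 r s {..<Suc n} \<subseteq> M1 r s C"
        using BC nC by (auto simp: M1_def less_Suc_eq subset_iff)
      then show ?thesis using rich(1) by blast
    next
      assume "rich R r s B"
      then show ?thesis using rich(2) rich_mono BC by blast
    qed
  qed simp
  have smallS: "k \<in> B'" if "k < Suc n" "s k \<le> 1 - r" for k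
  proof -
    have "k \<in> small r s C" using that small nC BC by (auto simp: small_def less_Suc_eq)
    then show ?thesis using steps(5) by (simp add: step_e_def)
  qed
  show ?thesis
    unfolding invariant_def
  proof (intro conjI)
    show "B' \<subseteq> {..<Suc n}" using B' CS by (rule subset_trans)
    show "admissible r s B'" using adm B' by (rule admissible_mono)
  qed (rule posS M1S | intro allI impI, rule smallS leastS pairsS triplesS unitsS; assumption)+
qed

section \<open>Packings of the items seen against packings of the buffer\<close>

lemma invariant_packing_medium:
  assumes inv: "invariant R r s n B" and X: "X \<subseteq> {..<n}" "\<forall>k\<in>X. 1 - r < s k" "sum s X \<le> 1"
  shows "\<exists>V\<subseteq>B. (\<forall>k\<in>V. 1 - r < s k) \<and> sum s V \<le> 1 \<and> r * sum s X \<le> sum s V"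
proof -
  note D = invariantD[OF inv]
  note B = D(1) and pos = D(2)[rule_format] and adm = D(4) and least = D(5)[rule_format]
    and pairs = D(6)[rule_format] and triples = D(7)[rule_format] and units = D(8)[rule_format]
  \<comment> \<open>The set \<open>V\<close> need not be related to \<open>X\<close>: it only
    witnesses that a unit has been seen, so that some unit, of size at least
    \<open>r\<^sup>2\<close>, is retained.\<close>
  have unit_suff: ?thesis if V: "V \<subseteq> {..<n}" "unit r s V" "sum s X \<le> r" for V
  proof -
    obtain U where U: "U \<subseteq> B" "unit r s U" using units[OF V(1,2)] by blast
    have "r * sum s X \<le> r\<^sup>2"
      using V(3) r_pos by (simp add: power2_eq_square)
    then have "r * sum s X \<le> sum s U" using unit_ge[OF U(2)] by simp
    moreover have "\<forall>k\<in>U. 1 - r < s k" using U(2) r_square_ge r_ge unfolding unit_def by force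
    ultimately show ?thesis using U(1) unit_le[OF U(2)] by (intro exI[of _ U]) simp
  qed
  have finX: "finite X" using X(1) finite_subset by blast
  have nonneg: "0 \<le> s k" if "k \<in> X" for k using X(2) r_le that by force
  consider "X = {}" | z where "X = {z}" | x y where "x \<noteq> y" "X = {x, y}"
    | x y z where "x \<noteq> y" "x \<noteq> z" "y \<noteq> z" "{x, y, z} \<subseteq> X"
  proof -
    have "X = {} \<or> (\<exists>z. X = {z}) \<or> (\<exists>x y. x \<noteq> y \<and> X = {x, y}) \<or>
        (\<exists>x y z. x \<noteq> y \<and> x \<noteq> z \<and> y \<noteq> z \<and> {x, y, z} \<subseteq> X)"
    proof (rule ccontr)
      assume *: "\<not> ?thesis"
      then obtain x where "x \<in> X" by blast
      moreover from this * obtain y where "y \<in> X" "y \<noteq> x" by blast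
      moreover from this calculation * obtain z where "z \<in> X" "z \<noteq> x" "z \<noteq> y" by blast
      ultimately have "x \<noteq> y \<and> x \<noteq> z \<and> y \<noteq> z \<and> {x, y, z} \<subseteq> X" by simp
      then show False using * by (elim notE, intro disjI2 exI)
    qed
    then show thesis by (elim disjE exE conjE) (rule that; assumption)+
  qed
  then show ?thesis
  proof cases
    case 1
    then show ?thesis by (intro exI[of _ "{}"]) simp
  next
    case (2 z)
    then have z: "z < n" "1 - r < s z" "s z < r" using X pos[of z] by auto
    show ?thesis
    proof (cases "r\<^sup>2 \<le> s z")
      case True
      then have "unit r s {z}" using z unfolding unit_def by blast
      then show ?thesis using unit_suff[of "{z}"] z 2 by simp
    next
      case False
      then obtain a where a: "a \<in> B" "1 - r < s a" "s a \<le> s z" using least[OF z(1,2)] z by auto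
      have an: "a < n" using a B by auto
      have a_suff: ?thesis if "r * s z \<le> s a"
        using that a 2 z r_le by (intro exI[of _ "{a}"]) simp
      show ?thesis
      proof (cases "a = z")
        case True
        then show ?thesis using a_suff mult_right_mono[of r 1 "s z"] z r_le by simp
      next
        case az: False
        show ?thesis
        proof (cases "s a < 2 * r - 1")
          case True
          then have "s z < 2 * r - 1"
            using pairs[of a z] az an z a(2) False r_upper by simp
          then have "unit r s {a, z}" using True a z az unfolding unit_def by blast
          then show ?thesis using unit_suff[of "{a, z}"] an z 2 by simp
        next
          case F: False
          have "r * s z \<le> r * r\<^sup>2" using False r_pos by simp
          then show ?thesis using F r_cube_le a_suff by simp
        qed
      qed
    qed
  next
    case (3 x y)
    then have xy: "x < n" "y < n" "1 - r < s x" "1 - r < s y" and sumX: "sum s X = s x + s y"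
      using X by auto
    have M1: "s x < 2 * r - 1" "s y < 2 * r - 1" using pairs[of x y] 3 xy X(3) sumX by auto
    then have unit: "unit r s {x, y}" using 3 xy unfolding unit_def by blast
    obtain a where a: "a \<in> B" "1 - r < s a" "\<forall>y<n. 1 - r < s y \<longrightarrow> s a \<le> s y"
      "\<forall>y<n. y \<noteq> a \<and> 1 - r < s y \<and> s y < 2 * r - 1 \<longrightarrow> s a + s y < r"
      using least[OF xy(1,3)] M1 r_square_ge by auto
    have a_xy: "s a \<le> s x" "s a \<le> s y" using a xy by auto
    have an: "a < n" using a B by auto
    have near: "s a + s k < r" if "k = x \<or> k = y" "k \<noteq> a" for k
      using a(4) that xy M1 by auto
    \<comment> \<open>If \<open>a\<close> is neither \<open>x\<close> nor \<open>y\<close>, the two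
      bounds from \<open>near\<close> add up. If it is one of them, the sum is below
      \<open>r\<close>, and \<open>2 * s a\<close> is at most the sum.\<close>
    have "s x + s y \<le> 2 * r - 2 * s a"
      using near[of x] near[of y] a_xy 3 by (cases "x = a"; cases "y = a") auto
    then have "r * sum s X \<le> r * (2 * r - 2 * s a)" using sumX r_pos by simp
    \<comment> \<open>Equivalent to \<open>2 * r\<^sup>2 - 1 \<le> s a * (2 * r - 1)\<close>; at the
      extreme value \<open>s a = 1 - r\<close> this reduces to \<open>r \<le> 3 / 4\<close>.
      Afterwards any retained packing of size at least \<open>1 - s a\<close> suffices.\<close>
    also have "\<dots> \<le> 1 - s a"
    proof -
      have "(1 - r) * (2 * r - 1) \<le> s a * (2 * r - 1)"
        using a(2) r_ge by (intro mult_right_mono) auto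
      moreover have "0 \<le> r * (3 - 4 * r)" using r_le r_pos by simp
      ultimately show ?thesis by (simp add: algebra_simps power2_eq_square)
    qed
    finally have bound: "r * sum s X \<le> 1 - s a" .
    have pair_suff: ?thesis
      if "p \<in> M1 r s B" "q \<in> M1 r s B" "p \<noteq> q" "r * sum s X \<le> s p + s q" for p q
      using that M1_D[OF that(1)] M1_D[OF that(2)] r_le by (intro exI[of _ "{p, q}"]) simp
    from D(9) show ?thesis
    proof
      assume "M1 r s {..<n} \<subseteq> B"
      then have "x \<in> M1 r s B" "y \<in> M1 r s B" using xy M1 by (auto simp: M1_def)
      moreover have "r * sum s X \<le> s x + s y"
        using mult_right_mono[of r 1 "sum s X"] sumX xy r_le by simp
      ultimately show ?thesis using pair_suff 3(1) by blast
    next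
      assume "rich R r s B"
      then consider (M4) c where "c \<in> M4 r s B"
        | (three) p q t where "p \<in> M1 r s B" "q \<in> M1 r s B" "t \<in> M1 r s B" "p \<noteq> q" "p \<noteq> t" "q \<noteq> t"
        | (two) p q where "p \<in> M1 r s B" "q \<in> M1 r s B" "p \<noteq> q" "R - r \<le> s p + s q"
        unfolding rich_def by blast
      then show ?thesis
      proof cases
        case (M4 c)
        note c = M4_D[OF M4]
        have "a \<noteq> c" using c a_xy M1 r_square_ge by auto
        \<comment> \<open>Otherwise admissibility would force the sum below \<open>r\<close>, but it
          exceeds \<open>(1 - r) + r\<^sup>2 \<ge> r\<close>.\<close>
        then have "1 < s a + s c"
          using admissible_pair[OF adm a(1), of c] c a(2) r_square_ge by force
        then show ?thesis using c bound r_square_ge r_ge r_le by (intro exI[of _ "{c}"]) simp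
      next
        case (three p q t)
        \<comment> \<open>At least two of the three items differ from \<open>a\<close>; since all
          three of \<open>a\<close>, \<open>u\<close>, \<open>v\<close> together exceed 1,
          \<open>u\<close> and \<open>v\<close> alone exceed \<open>1 - s a\<close>.\<close>
        then obtain u v where uv: "u \<in> M1 r s B" "v \<in> M1 r s B" "u \<noteq> v" "u \<noteq> a" "v \<noteq> a"
          by metis
        have "1 < s a + s u + s v"
          using triples[of a u v] uv M1_D[OF uv(1)] M1_D[OF uv(2)] an a(2) B by auto
        then show ?thesis using pair_suff[OF uv(1-3)] bound by simp
      next
        case (two p q)
        \<comment> \<open>Two \<open>M1\<close> items weigh less than
          \<open>2 * (2 * r - 1)\<close>, and \<open>r\<close> times this is exactly the bound
          \<open>R - r\<close> in \<open>rich\<close>.\<close>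
        have "r * sum s X \<le> r * (4 * r - 2)" using M1 sumX r_pos by simp
        also have "\<dots> = R - r" by (simp add: R_eq algebra_simps power2_eq_square)
        finally show ?thesis using pair_suff[OF two(1-3)] two(4) by simp
      qed
    qed
  next
    case (4 x y z)
    then have "x < n" "y < n" "z < n" using X by auto
    then have "1 < s x + s y + s z" using triples[of x y z] 4 X(2) by simp
    moreover have "sum s {x, y, z} \<le> sum s X"
      using 4 finX nonneg by (intro sum_mono2) auto
    ultimately show ?thesis using 4 X(3) by simp
  qed
qed

text \<open>Only the non-small part of \<open>P\<close> loses the factor \<open>r\<close>: every
  small item seen is retained, and all of them fit on top of the packing found for the non-small
  part.\<close>

lemma invariant_packing:
  assumes inv: "invariant R r s n B" and P: "P \<subseteq> {..<n}" "sum s P \<le> 1"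
  shows "\<exists>T\<subseteq>B. sum s T \<le> 1 \<and> r * sum s P \<le> sum s T"
proof -
  note D = invariantD[OF inv]
  define X where "X = {k \<in> P. 1 - r < s k}"
  define S where "S = small r s B"
  have finP: "finite P" and finB: "finite B" using P(1) D(1) finite_subset by blast+
  have nonneg: "0 \<le> s k" if "k < n" for k using D(2) that by force
  have P_split: "sum s P = sum s X + sum s (P - X)"
    using finP sum.subset_diff[of X P s] by (simp add: X_def add.commute)
  have "0 \<le> sum s (P - X)" using P nonneg by (intro sum_nonneg) auto
  then have "sum s X \<le> 1" using P_split P(2) by simp
  then obtain V where V: "V \<subseteq> B" "\<forall>k\<in>V. 1 - r < s k" "sum s V \<le> 1" "r * sum s X \<le> sum s V"
    using invariant_packing_medium[OF inv, of X] P(1) unfolding X_def by blast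
  have "P - X \<subseteq> S" using P(1) D(3) by (auto simp: X_def S_def small_def)
  then have "sum s (P - X) \<le> sum s S"
    using finB D(1) nonneg by (intro sum_mono2) (auto simp: S_def small_def)
  moreover have "r * sum s (P - X) \<le> sum s (P - X)"
    using mult_right_mono[of r 1] \<open>0 \<le> sum s (P - X)\<close> r_le by simp
  ultimately have "r * sum s P \<le> sum s V + sum s S"
    using V(4) P_split by (simp add: distrib_left)
  moreover have "V \<inter> S = {}" using V(2) by (force simp: S_def small_def)
  then have "sum s (V \<union> S) = sum s V + sum s S"
    using finB V(1) by (intro sum.union_disjoint) (auto simp: S_def small_def intro: finite_subset)
  moreover have "sum s (V \<union> S) < r"
    using admissible_add_small[OF D(4) finB V(1,3)] by (simp add: S_def)
  moreover have "V \<union> S \<subseteq> B" using V(1) by (auto simp: S_def small_def)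
  ultimately show ?thesis using r_le by (intro exI[of _ "V \<union> S"]) simp
qed

section \<open>The state after a round\<close>

lemma round_outcome:
  assumes thr: "threshold R = r" and round: "algorithm_round R s (insert n B) B'"
    and n: "0 < s n" "s n \<le> 1"
    and state: "(r \<le> sum s B \<and> sum s B \<le> 1) \<or> invariant R r s n B"
  shows "(r \<le> sum s B' \<and> sum s B' \<le> 1) \<or> invariant R r s (Suc n) B'" and "sum s B' \<le> R"
proof -
  have "((r \<le> sum s B' \<and> sum s B' \<le> 1) \<or> invariant R r s (Suc n) B') \<and> sum s B' \<le> R"
  proof (cases "\<exists>D\<subseteq>insert n B. r \<le> sum s D \<and> sum s D \<le> 1")
    case True
    then have "r \<le> sum s B' \<and> sum s B' \<le> 1"
      using round unfolding algorithm_round_def Let_def thr if_P[OF True] by blast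
    moreover have "1 \<le> R" using r_square_add_le_R r_lower r_ge by simp
    ultimately show ?thesis by simp
  next
    case False
    then have adm: "admissible r s (insert n B)" unfolding admissible_def by blast
    \<comment> \<open>A buffer of size in [r, 1] is itself a witness for the test of the next round,
      so that state is permanent and cannot precede a failed test.\<close>
    have "\<not> (r \<le> sum s B \<and> sum s B \<le> 1)" using False by (meson subset_insertI)
    then have inv: "invariant R r s n B" using state by blast
    obtain Ba Bb Bc Bd where steps:
      "step_a r s (insert n B) {} Ba" "step_b r s (insert n B) Ba Bb"
      "step_c r s (insert n B) Bb Bc" "step_d R r s (insert n B) Bc Bd"
      "step_e r s (insert n B) Bd B'"
      using round unfolding algorithm_round_def Let_def thr if_not_P[OF False] by blast
    note D = invariantD(1,2)[OF inv]
    have "finite (insert n B)" using D(1) finite_subset by auto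
    moreover have "\<forall>k\<in>insert n B. 0 < s k" using D n by auto
    moreover have "\<forall>k\<in>insert n B. s k < r"
      using D admissible_less[OF adm, of n] n by auto
    ultimately have "sum s B' \<le> R" using round_size[OF steps _ adm] by blast
    then show ?thesis using invariant_step[OF inv steps adm n] by blast
  qed
  then show "(r \<le> sum s B' \<and> sum s B' \<le> 1) \<or> invariant R r s (Suc n) B'" and "sum s B' \<le> R"
    by blast+
qed

lemma invariant_empty: "invariant R r s 0 {}"
  unfolding invariant_def admissible_def unit_def using r_pos by (simp add: M1_def)

end

section \<open>The range of the capacity in terms of the threshold\<close>

lemma threshold_bounds:
  assumes "2 - sqrt 2 / 2 \<le> R" "R \<le> 17 - 9 * sqrt 3"
  defines "r \<equiv> threshold R"
  shows "0 < r" "1 / 2 \<le> r\<^sup>2" "r\<^sup>2 + 2 * r \<le> 2" "R = 4 * r\<^sup>2 - r"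
    "(sqrt (16 * R + 1) - 1) / (2 * R) = 1 / r"
proof -
  \<comment> \<open>The right-hand sides are the values of \<open>16 * R + 1\<close> at the two ends
    of the range of \<open>R\<close>.\<close>
  have sq: "(4 * sqrt 2 - 1)\<^sup>2 = 33 - 8 * sqrt 2" "(8 * sqrt 3 - 9)\<^sup>2 = 273 - 144 * sqrt 3"
    by (simp_all add: power2_diff power_mult_distrib)
  have sqrt_eq: "sqrt (16 * R + 1) = 8 * r - 1" by (simp add: r_def threshold_def add_divide_distrib)
  have "4 * sqrt 2 - 1 \<le> sqrt (16 * R + 1)"
    by (rule real_le_rsqrt) (use assms(1) sq(1) in simp)
  then have lower: "sqrt 2 / 2 \<le> r" using sqrt_eq by simp
  \<comment> \<open>Makes \<open>8 * sqrt 3 - 9\<close> nonnegative, as squaring requires.\<close>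
  have "9 / 8 \<le> sqrt (3 :: real)" by (rule real_le_rsqrt) (simp add: power2_eq_square)
  then have "sqrt (16 * R + 1) \<le> 8 * sqrt 3 - 9"
    by (intro real_le_lsqrt) (use assms(2) sq(2) in simp_all)
  then have upper: "r + 1 \<le> sqrt 3" using sqrt_eq by simp
  show r: "0 < r" using lower by (rule less_le_trans[rotated]) simp
  show "1 / 2 \<le> r\<^sup>2"
    using power_mono[OF lower, of 2] by (simp add: power_divide)
  show "r\<^sup>2 + 2 * r \<le> 2"
    using power_mono[OF upper, of 2] r by (simp add: power2_eq_square algebra_simps)
  have "sqrt 2 \<le> 2" by (rule real_le_lsqrt) simp_all
  then have "0 \<le> 16 * R + 1" using assms(1) by simp
  then have "(8 * r - 1)\<^sup>2 = 16 * R + 1" by (simp flip: sqrt_eq)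
  then show R: "R = 4 * r\<^sup>2 - r" by (simp add: power2_eq_square algebra_simps)
  have "1 \<le> sqrt (2 :: real)" by simp
  \<comment> \<open>The common factor to cancel: the numerator is \<open>2 * (4 * r - 1)\<close> and
    \<open>R = r * (4 * r - 1)\<close>.\<close>
  then have "4 * r - 1 \<noteq> 0" using lower by linarith
  then show "(sqrt (16 * R + 1) - 1) / (2 * R) = 1 / r"
    using r unfolding sqrt_eq by (simp add: R power2_eq_square divide_simps) (simp add: algebra_simps)
qed

section \<open>Proportional inputs and optimal packings\<close>

lemma proportional_snoc:
  assumes "I @ [e] \<in> proportional_inputs"
  shows "I \<in> proportional_inputs" "0 < item_size e" "item_size e \<le> 1"
  using assms by (auto simp: proportional_inputs_def knapsack_inputs_def)

lemma total_value_proportional: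
  assumes "I \<in> proportional_inputs" "B \<subseteq> {..<length I}"
  shows "total_value I B = total_size I B"
  using assms unfolding total_value_def total_size_def proportional_inputs_def
  by (intro sum.cong) auto

lemma best_packing_ge:
  assumes "finite C" "B \<subseteq> C" "total_size I B \<le> 1"
  shows "total_value I B \<le> best_packing I C"
proof -
  have "{total_value I B |B. B \<subseteq> C \<and> total_size I B \<le> 1} \<subseteq> total_value I ` Pow C" by auto
  then have "finite {total_value I B |B. B \<subseteq> C \<and> total_size I B \<le> 1}"
    using assms(1) by (meson finite_Pow_iff finite_imageI finite_subset)
  then show ?thesis unfolding best_packing_def using assms by (intro Max_ge) auto
qed

lemma best_packing_attained:
  assumes "finite C"
  obtains B where "B \<subseteq> C" "total_size I B \<le> 1" "best_packing I C = total_value I B"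
proof -
  let ?A = "{total_value I B |B. B \<subseteq> C \<and> total_size I B \<le> 1}"
  have "?A \<subseteq> total_value I ` Pow C" by auto
  then have "finite ?A" using assms by (meson finite_Pow_iff finite_imageI finite_subset)
  moreover have "total_value I {} \<in> ?A" by (auto simp: total_size_def intro!: exI[of _ "{}"])
  ultimately have "Max ?A \<in> ?A" by (intro Max_in) auto
  then show thesis using that unfolding best_packing_def by auto
qed

section \<open>The competitive ratio\<close>

theorem theorem14:
  fixes R :: real and alg :: "item list \<Rightarrow> nat set"
  assumes "2 - sqrt 2 / 2 \<le> R" and "R \<le> 17 - 9 * sqrt 3"
    and "implements_algorithm R proportional_inputs alg"
  shows "removable_online_algorithm R proportional_inputs alg \<and>
         competitive ((sqrt (16 * R + 1) - 1) / (2 * R)) proportional_inputs alg"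
proof -
  define r where "r = threshold R"
  note r = threshold_bounds[OF assms(1,2), folded r_def]
  note params = r(1-4)
  let ?s = "\<lambda>I k. item_size (I ! k)"
  \<comment> \<open>The state carried through the induction on the input: the buffer is already a
    packing of size at least \<open>r\<close>, or no such packing has been met and the invariant
    holds.\<close>
  define good where "good I \<longleftrightarrow>
      (r \<le> sum (?s I) (alg I) \<and> sum (?s I) (alg I) \<le> 1) \<or>
      invariant R r (?s I) (length I) (alg I)" for I
  have Nil: "alg [] = {}"
    and round: "\<And>I e. I @ [e] \<in> proportional_inputs \<Longrightarrow>
      algorithm_round R (?s (I @ [e])) (insert (length I) (alg I)) (alg (I @ [e]))"
    using assms(3) unfolding implements_algorithm_def by blast+
  have step: "alg (I @ [e]) \<subseteq> insert (length I) (alg I) \<and> good (I @ [e]) \<and>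
      sum (?s (I @ [e])) (alg (I @ [e])) \<le> R"
    if I: "I @ [e] \<in> proportional_inputs" "alg I \<subseteq> {..<length I}" "good I" for I e
  proof -
    have eq: "?s I k = ?s (I @ [e]) k" if "k < length I" for k
      using that by (simp add: nth_append)
    have "sum (?s I) (alg I) = sum (?s (I @ [e])) (alg I)"
      using I(2) eq by (intro sum.cong) auto
    then have "(r \<le> sum (?s (I @ [e])) (alg I) \<and> sum (?s (I @ [e])) (alg I) \<le> 1) \<or>
        invariant R r (?s (I @ [e])) (length I) (alg I)"
      using I(3) invariant_cong[OF _ eq] unfolding good_def by auto
    then show ?thesis
      using round_outcome[OF params r_def[symmetric] round[OF I(1)]]
        proportional_snoc(2,3)[OF I(1)] algorithm_round_subset[OF round[OF I(1)]]
      unfolding good_def by simp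
  qed
  have state: "alg I \<subseteq> {..<length I} \<and> good I" if "I \<in> proportional_inputs" for I
    using that
  proof (induction I rule: rev_induct)
    case Nil
    then show ?case using \<open>alg [] = {}\<close> invariant_empty[OF params] by (simp add: good_def)
  next
    case (snoc e I)
    then have "alg I \<subseteq> {..<length I} \<and> good I" using proportional_snoc(1) by blast
    then show ?case using step[OF snoc.prems] by fastforce
  qed
  have "removable_online_algorithm R proportional_inputs alg"
    unfolding removable_online_algorithm_def total_size_def
    using Nil step state proportional_snoc(1) by blast
  moreover have "OPT I \<le> 1 / r * ALG alg I" if I: "I \<in> proportional_inputs" for I
  proof -
    have sub: "alg I \<subseteq> {..<length I}" and "good I" using state[OF I] by auto
    have fin: "finite (alg I)" using sub finite_subset by blast
    obtain P where P: "P \<subseteq> {..<length I}" "total_size I P \<le> 1" "OPT I = total_size I P"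
      using best_packing_attained[of "{..<length I}" I] total_value_proportional[OF I]
      unfolding OPT_def by (metis finite_lessThan)
    have "\<exists>T\<subseteq>alg I. total_size I T \<le> 1 \<and> r * total_size I P \<le> total_size I T"
      using \<open>good I\<close> unfolding good_def
    proof
      \<comment> \<open>The whole buffer is a packing of size at least \<open>r\<close>, and
        \<open>P\<close> has size at most 1.\<close>
      assume "r \<le> sum (?s I) (alg I) \<and> sum (?s I) (alg I) \<le> 1"
      moreover have "r * total_size I P \<le> r" using P(2) r(1) by simp
      ultimately show ?thesis
        by (intro exI[of _ "alg I"]) (simp add: total_size_def)
    next
      assume "invariant R r (?s I) (length I) (alg I)"
      then show ?thesis
        using invariant_packing[OF params _ P(1)] P(2) unfolding total_size_def by blast
    qed
    then obtain T where T: "T \<subseteq> alg I" "total_size I T \<le> 1" "r * total_size I P \<le> total_size I T"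
      by blast
    have "total_size I T \<le> ALG alg I"
      using best_packing_ge[OF fin T(1,2)] total_value_proportional[OF I] T(1) sub
      unfolding ALG_def by (metis subset_trans)
    then have "r * OPT I \<le> ALG alg I" using T(3) P(3) by simp
    then show ?thesis using r(1) by (simp add: pos_le_divide_eq mult.commute)
  qed
  ultimately show ?thesis unfolding competitive_def r(5) by blast
qed

end
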